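(* Let $H$ and $K$ be arbitrary groups, and let $A\le H$ and $B\le K$ be isomorphic subgroups. Let $G=H\ast_{A=B}K$ be the amalgamated free product (amalgamating $A$ with $B$ via a fixed isomorphism). Then: (1) $G$ is weakly hyperbolic relative to $\{H,K\}$. (2) If $H$ is weakly hyperbolic relative to $\{A\}$ and $K$ is weakly hyperbolic relative to $\{B\}$, then $G$ is weakly hyperbolic relative to $\{A\}$.
   Context: Let $G$ be a group and $\mathcal H=\{H_1,\ldots,H_m\}$ a collection of subgroups of $G$. A subset $X\subset G$ is a relative generating set of $G$ with respect to $\mathcal H$ if $G$ is generated by $X\cup H_1\cup\cdots\cup H_m$. The relative Cayley graph of $G$ with respect to $\mathcal H$ (and $X$) is the Cayley graph of $G$ with respect to the generating set $X\cup H_1\cup\cdots\cup H_m$, with the combinatorial metric (every edge has length 1). $G$ is weakly hyperbolic relative to $\mathcal H$ if there exists a finite relative generating set $X$ of $G$ with respect to $\mathcal H$ such that the corresponding relative Cayley graph is a hyperbolic metric space. *)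

theory Defs
  imports "HOL-Algebra.Algebra"
begin

text \<open>Combinatorial distance in the Cayley graph of G with respect to a generating set S:
  vertices are the elements of G, and g is joined by an edge of length 1 to g s for s in S
  (equivalently to g s^-1). The distance from x to y is the least number of edges of a path,
  i.e. the least length of a word in S and its inverses representing x^-1 y.\<close>

definition cayley_dist :: "('a, 'b) monoid_scheme \<Rightarrow> 'a set \<Rightarrow> 'a \<Rightarrow> 'a \<Rightarrow> nat" where
  "cayley_dist G S x y =
     (LEAST n. \<exists>ws. length ws = n \<and> set ws \<subseteq> S \<union> m_inv G ` S
                 \<and> x \<otimes>\<^bsub>G\<^esub> foldr (\<otimes>\<^bsub>G\<^esub>) ws \<one>\<^bsub>G\<^esub> = y)"

definition gromov_product :: "('a \<Rightarrow> 'a \<Rightarrow> real) \<Rightarrow> 'a \<Rightarrow> 'a \<Rightarrow> 'a \<Rightarrow> real" where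
  "gromov_product d w x y = (d x w + d y w - d x y) / 2"

definition gromov_hyperbolic :: "'a set \<Rightarrow> ('a \<Rightarrow> 'a \<Rightarrow> real) \<Rightarrow> bool" where
  "gromov_hyperbolic V d \<longleftrightarrow>
     (\<exists>\<delta>::real. \<forall>x\<in>V. \<forall>y\<in>V. \<forall>z\<in>V. \<forall>w\<in>V.
        gromov_product d w x z \<ge> min (gromov_product d w x y) (gromov_product d w y z) - \<delta>)"

definition weakly_rel_hyperbolic :: "('a, 'b) monoid_scheme \<Rightarrow> 'a set set \<Rightarrow> bool" where
  "weakly_rel_hyperbolic G Hs \<longleftrightarrow>
     (\<exists>S. finite S \<and> S \<subseteq> carrier G \<and>
          generate G (S \<union> \<Union>Hs) = carrier G \<and>
          gromov_hyperbolic (carrier G)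
            (\<lambda>x y. real (cayley_dist G (S \<union> \<Union>Hs) x y)))"

definition amalg_letters :: "('h, 'c) monoid_scheme \<Rightarrow> ('k, 'd) monoid_scheme \<Rightarrow> ('h + 'k) set" where
  "amalg_letters H K = Inl ` carrier H \<union> Inr ` carrier K"

inductive amalg_rel :: "('h, 'c) monoid_scheme \<Rightarrow> ('k, 'd) monoid_scheme \<Rightarrow> 'h set \<Rightarrow> ('h \<Rightarrow> 'k)
    \<Rightarrow> ('h + 'k) list \<Rightarrow> ('h + 'k) list \<Rightarrow> bool"
  for H K A \<phi> where
  refl: "set w \<subseteq> amalg_letters H K \<Longrightarrow> amalg_rel H K A \<phi> w w"
| sym: "amalg_rel H K A \<phi> u v \<Longrightarrow> amalg_rel H K A \<phi> v u"
| trans: "amalg_rel H K A \<phi> u v \<Longrightarrow> amalg_rel H K A \<phi> v w \<Longrightarrow> amalg_rel H K A \<phi> u w"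
| append: "amalg_rel H K A \<phi> u v \<Longrightarrow> amalg_rel H K A \<phi> u' v' \<Longrightarrow>
           amalg_rel H K A \<phi> (u @ u') (v @ v')"
| multH: "x \<in> carrier H \<Longrightarrow> y \<in> carrier H \<Longrightarrow>
          amalg_rel H K A \<phi> [Inl x, Inl y] [Inl (x \<otimes>\<^bsub>H\<^esub> y)]"
| oneH: "amalg_rel H K A \<phi> [Inl \<one>\<^bsub>H\<^esub>] []"
| multK: "x \<in> carrier K \<Longrightarrow> y \<in> carrier K \<Longrightarrow>
          amalg_rel H K A \<phi> [Inr x, Inr y] [Inr (x \<otimes>\<^bsub>K\<^esub> y)]"
| oneK: "amalg_rel H K A \<phi> [Inr \<one>\<^bsub>K\<^esub>] []"
| amalg: "a \<in> A \<Longrightarrow> amalg_rel H K A \<phi> [Inl a] [Inr (\<phi> a)]"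

definition amalg_class :: "('h, 'c) monoid_scheme \<Rightarrow> ('k, 'd) monoid_scheme \<Rightarrow> 'h set \<Rightarrow> ('h \<Rightarrow> 'k)
    \<Rightarrow> ('h + 'k) list \<Rightarrow> ('h + 'k) list set" where
  "amalg_class H K A \<phi> w = {v. amalg_rel H K A \<phi> w v}"

definition amalg_prod :: "('h, 'c) monoid_scheme \<Rightarrow> ('k, 'd) monoid_scheme \<Rightarrow> 'h set \<Rightarrow> ('h \<Rightarrow> 'k)
    \<Rightarrow> ('h + 'k) list set monoid" where
  "amalg_prod H K A \<phi> =
     \<lparr> carrier = amalg_class H K A \<phi> ` {w. set w \<subseteq> amalg_letters H K},
       monoid.mult = (\<lambda>P Q. {w. \<exists>u\<in>P. \<exists>v\<in>Q. amalg_rel H K A \<phi> (u @ v) w}),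
       monoid.one = amalg_class H K A \<phi> [] \<rparr>"

definition amalg_inl :: "('h, 'c) monoid_scheme \<Rightarrow> ('k, 'd) monoid_scheme \<Rightarrow> 'h set \<Rightarrow> ('h \<Rightarrow> 'k)
    \<Rightarrow> 'h \<Rightarrow> ('h + 'k) list set" where
  "amalg_inl H K A \<phi> h = amalg_class H K A \<phi> [Inl h]"

definition amalg_inr :: "('h, 'c) monoid_scheme \<Rightarrow> ('k, 'd) monoid_scheme \<Rightarrow> 'h set \<Rightarrow> ('h \<Rightarrow> 'k)
    \<Rightarrow> 'k \<Rightarrow> ('h + 'k) list set" where
  "amalg_inr H K A \<phi> k = amalg_class H K A \<phi> [Inr k]"

end

theory Submission
  imports Defs "HOL-Library.Sublist"
begin

text \<open>
  Both parts are instances of one statement: if \<open>A \<subseteq> S \<subseteq> H\<close> and \<open>B \<subseteq> T \<subseteq> K\<close> are generating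
  sets with hyperbolic Cayley graphs, then the Cayley graph of \<open>G\<close> with respect to \<open>S \<union> T\<close> is
  hyperbolic.  Part (1) is the case \<open>S = H\<close>, \<open>T = K\<close>; part (2) takes finite sets
  enlarged by \<open>A\<close> and \<open>B\<close>.

  The Cayley graph of \<open>G\<close> is a tree of copies of the Cayley graphs of \<open>H\<close> and \<open>K\<close>, glued along
  the cosets of \<open>A\<close>, which have diameter at most 1.  Every path between points on different
  sides of a coset \<open>g A\<close> meets that coset, so distances are additive through it up to an error
  of 2.  Consequently the copies of \<open>H\<close> and \<open>K\<close> are isometrically embedded, and the Gromov
  product of \<open>x\<close> and \<open>y\<close> at 1 is, up to a constant, the distance from 1 to the vertex space where
  the tree paths to \<open>x\<close> and \<open>y\<close> branch plus the Gromov product of the two exit points inside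
  that vertex space.  The four-point condition of the vertex spaces then carries over.\<close>

section \<open>Cayley graph distances\<close>

context group
begin

abbreviation word_prod :: "'a list \<Rightarrow> 'a" where
  "word_prod ws \<equiv> foldr (\<otimes>) ws \<one>"

abbreviation sym_gens :: "'a set \<Rightarrow> 'a set" where
  "sym_gens S \<equiv> S \<union> m_inv G ` S"

lemma word_prod_closed: "set ws \<subseteq> carrier G \<Longrightarrow> word_prod ws \<in> carrier G"
  by (induction ws) auto

lemma word_prod_append:
  "set u \<subseteq> carrier G \<Longrightarrow> set v \<subseteq> carrier G \<Longrightarrow> word_prod (u @ v) = word_prod u \<otimes> word_prod v"
  by (induction u) (auto simp: word_prod_closed m_assoc)

lemma sym_gens_closed: "S \<subseteq> carrier G \<Longrightarrow> sym_gens S \<subseteq> carrier G"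
  by auto

lemma word_prod_inv:
  assumes "S \<subseteq> carrier G" "set ws \<subseteq> sym_gens S"
  shows "\<exists>vs. length vs = length ws \<and> set vs \<subseteq> sym_gens S \<and> word_prod vs = inv (word_prod ws)"
  using assms(2)
proof (induction ws)
  case Nil
  then show ?case by simp
next
  case (Cons s ws)
  then obtain vs where vs: "length vs = length ws" "set vs \<subseteq> sym_gens S"
    "word_prod vs = inv (word_prod ws)" by auto
  have C: "s \<in> carrier G" "set ws \<subseteq> carrier G" "set vs \<subseteq> carrier G"
    using Cons.prems vs(2) sym_gens_closed[OF assms(1)] by auto
  have "inv s \<in> sym_gens S"
    using Cons.prems assms(1) by auto
  moreover have "word_prod (vs @ [inv s]) = inv (word_prod (s # ws))"
    using C vs(3) by (simp add: word_prod_append inv_mult_group word_prod_closed del: foldr_append)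
  ultimately show ?case
    using vs by (intro exI[of _ "vs @ [inv s]"]) auto
qed

lemma generate_iff_word:
  assumes "S \<subseteq> carrier G"
  shows "x \<in> generate G S \<longleftrightarrow> (\<exists>ws. set ws \<subseteq> sym_gens S \<and> word_prod ws = x)"
proof
  show "x \<in> generate G S \<Longrightarrow> \<exists>ws. set ws \<subseteq> sym_gens S \<and> word_prod ws = x"
  proof (induction rule: generate.induct)
    case one
    then show ?case by (intro exI[of _ "[]"]) auto
  next
    case (incl h)
    then show ?case using assms by (intro exI[of _ "[h]"]) auto
  next
    case (inv h)
    then show ?case using assms by (intro exI[of _ "[inv h]"]) auto
  next
    case (eng g h)
    then obtain u v where "set u \<subseteq> sym_gens S" "word_prod u = g"
      "set v \<subseteq> sym_gens S" "word_prod v = h" by auto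
    then show ?case
      using word_prod_append[of u v] sym_gens_closed[OF assms]
      by (intro exI[of _ "u @ v"]) auto
  qed
next
  assume "\<exists>ws. set ws \<subseteq> sym_gens S \<and> word_prod ws = x"
  then obtain ws where "set ws \<subseteq> sym_gens S" "word_prod ws = x" by auto
  then show "x \<in> generate G S"
    by (induction ws arbitrary: x) (auto intro: generate.intros)
qed

lemma cayley_dist_le:
  "set ws \<subseteq> sym_gens S \<Longrightarrow> x \<otimes> word_prod ws = y \<Longrightarrow> cayley_dist G S x y \<le> length ws"
  unfolding cayley_dist_def by (rule Least_le) auto

text \<open>Membership in \<open>generate G S\<close> makes the set of admissible lengths nonempty;
  otherwise the \<open>LEAST\<close> in \<open>cayley_dist\<close> would be an unspecified
  number.\<close>

lemma cayley_dist_word: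
  assumes "S \<subseteq> carrier G" "x \<in> carrier G" "y \<in> carrier G" "inv x \<otimes> y \<in> generate G S"
  obtains ws where "length ws = cayley_dist G S x y" "set ws \<subseteq> sym_gens S"
    "x \<otimes> word_prod ws = y"
proof -
  obtain ws where ws: "set ws \<subseteq> sym_gens S" "word_prod ws = inv x \<otimes> y"
    using assms generate_iff_word by auto
  then have "x \<otimes> word_prod ws = y"
    using assms by (simp flip: m_assoc)
  then have "\<exists>n ws. length ws = n \<and> set ws \<subseteq> sym_gens S \<and> x \<otimes> word_prod ws = y"
    using ws by blast
  from LeastI_ex[OF this] show ?thesis
    using that unfolding cayley_dist_def by blast
qed

text \<open>Left multiplication cancels, so the same words join the translated points and both
  minima range over one set.\<close>

lemma cayley_dist_translate:
  assumes "S \<subseteq> carrier G" "g \<in> carrier G" "x \<in> carrier G" "y \<in> carrier G"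
  shows "cayley_dist G S (g \<otimes> x) (g \<otimes> y) = cayley_dist G S x y"
proof -
  have "g \<otimes> x \<otimes> word_prod ws = g \<otimes> y \<longleftrightarrow> x \<otimes> word_prod ws = y"
    if "set ws \<subseteq> sym_gens S" for ws
  proof -
    have "word_prod ws \<in> carrier G"
      by (intro word_prod_closed order_trans[OF that] sym_gens_closed assms)
    then show ?thesis using assms(2-4) by (simp add: m_assoc)
  qed
  then show ?thesis
    unfolding cayley_dist_def by (intro arg_cong[where f = Least] ext) blast
qed

lemma cayley_dist_commute:
  assumes "S \<subseteq> carrier G" "x \<in> carrier G" "y \<in> carrier G" "inv x \<otimes> y \<in> generate G S"
  shows "cayley_dist G S x y = cayley_dist G S y x"
proof -
  have *: "cayley_dist G S y x \<le> cayley_dist G S x y"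
    if xy: "x \<in> carrier G" "y \<in> carrier G" "inv x \<otimes> y \<in> generate G S" for x y
  proof -
    obtain ws where ws: "length ws = cayley_dist G S x y" "set ws \<subseteq> sym_gens S"
      "x \<otimes> word_prod ws = y"
      using cayley_dist_word[OF assms(1) xy] by blast
    obtain vs where vs: "length vs = length ws" "set vs \<subseteq> sym_gens S"
      "word_prod vs = inv (word_prod ws)"
      using word_prod_inv[OF assms(1) ws(2)] by blast
    have "word_prod ws \<in> carrier G"
      using ws(2) sym_gens_closed[OF assms(1)] by (intro word_prod_closed) auto
    then have "y \<otimes> word_prod vs = x"
      using ws(3) vs(3) xy by (simp add: inv_solve_right')
    then show ?thesis
      using cayley_dist_le[OF vs(2)] vs(1) ws(1) by metis
  qed
  have "inv y \<otimes> x = inv (inv x \<otimes> y)"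
    using assms by (simp add: inv_mult_group)
  then have "inv y \<otimes> x \<in> generate G S"
    using assms(4) subgroup.m_inv_closed[OF generate_is_subgroup[OF assms(1)]] by simp
  with *[OF assms(2-4)] *[OF assms(3,2)] show ?thesis by linarith
qed

lemma cayley_dist_triangle:
  assumes "S \<subseteq> carrier G" "x \<in> carrier G" "y \<in> carrier G" "z \<in> carrier G"
    "inv x \<otimes> y \<in> generate G S" "inv y \<otimes> z \<in> generate G S"
  shows "cayley_dist G S x z \<le> cayley_dist G S x y + cayley_dist G S y z"
proof -
  obtain u where u: "length u = cayley_dist G S x y" "set u \<subseteq> sym_gens S" "x \<otimes> word_prod u = y"
    using cayley_dist_word assms by metis
  obtain v where v: "length v = cayley_dist G S y z" "set v \<subseteq> sym_gens S" "y \<otimes> word_prod v = z"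
    using cayley_dist_word assms by metis
  have C: "set u \<subseteq> carrier G" "set v \<subseteq> carrier G"
    using u(2) v(2) sym_gens_closed[OF assms(1)] by auto
  have "x \<otimes> word_prod (u @ v) = z"
    using C u(3) v(3) assms by (simp add: word_prod_append word_prod_closed flip: m_assoc del: foldr_append)
  then have "cayley_dist G S x z \<le> length (u @ v)"
    using u(2) v(2) by (intro cayley_dist_le) auto
  then show ?thesis using u(1) v(1) by simp
qed

lemma cayley_dist_gen_le:
  assumes "S \<subseteq> carrier G" "x \<in> carrier G" "y \<in> carrier G" "inv x \<otimes> y \<in> S"
  shows "cayley_dist G S x y \<le> 1"
  using cayley_dist_le[of "[inv x \<otimes> y]" S x y] assms by (simp add: inv_solve_left flip: m_assoc)

lemma cayley_dist_antimono:
  assumes "S \<subseteq> S'" "S' \<subseteq> carrier G" "x \<in> carrier G" "y \<in> carrier G" "inv x \<otimes> y \<in> generate G S"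
  shows "cayley_dist G S' x y \<le> cayley_dist G S x y"
proof -
  obtain ws where "length ws = cayley_dist G S x y" "set ws \<subseteq> sym_gens S" "x \<otimes> word_prod ws = y"
    using cayley_dist_word[of S x y] assms by (metis subset_trans)
  moreover have "sym_gens S \<subseteq> sym_gens S'"
    using assms(1) by auto
  ultimately show ?thesis
    using cayley_dist_le[of ws S' x y] by (metis subset_trans)
qed

end

lemma (in group_hom) hom_word_prod:
  "set ws \<subseteq> carrier G \<Longrightarrow> foldr (\<otimes>\<^bsub>H\<^esub>) (map h ws) \<one>\<^bsub>H\<^esub> = h (foldr (\<otimes>\<^bsub>G\<^esub>) ws \<one>\<^bsub>G\<^esub>)"
  by (induction ws) (auto simp: G.word_prod_closed)

lemma (in group_hom) cayley_dist_image:
  assumes "inj_on h (carrier G)" "S \<subseteq> carrier G" "x \<in> carrier G" "y \<in> carrier G"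
  shows "cayley_dist H (h ` S) (h x) (h y) = cayley_dist G S x y"
proof -
  have "m_inv H ` h ` S = h ` m_inv G ` S"
    unfolding image_image using assms(2) by (intro image_cong) auto
  then have sym: "H.sym_gens (h ` S) = h ` G.sym_gens S"
    by (simp only: image_Un)
  have "(\<exists>vs. length vs = n \<and> set vs \<subseteq> H.sym_gens (h ` S) \<and> h x \<otimes>\<^bsub>H\<^esub> H.word_prod vs = h y)
     \<longleftrightarrow> (\<exists>ws. length ws = n \<and> set ws \<subseteq> G.sym_gens S \<and> x \<otimes>\<^bsub>G\<^esub> G.word_prod ws = y)" (is "?L \<longleftrightarrow> ?R") for n
  proof -
    have *: "h x \<otimes>\<^bsub>H\<^esub> H.word_prod (map h ws) = h y \<longleftrightarrow> x \<otimes>\<^bsub>G\<^esub> G.word_prod ws = y"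
      if "set ws \<subseteq> G.sym_gens S" for ws
    proof -
      have C: "set ws \<subseteq> carrier G"
        using that G.sym_gens_closed[OF assms(2)] by auto
      then have "h x \<otimes>\<^bsub>H\<^esub> H.word_prod (map h ws) = h (x \<otimes>\<^bsub>G\<^esub> G.word_prod ws)"
        using assms(3) by (simp add: hom_word_prod G.word_prod_closed)
      then show ?thesis
        using inj_on_eq_iff[OF assms(1), of "x \<otimes> G.word_prod ws" y] C assms(3,4)
        by (simp add: G.word_prod_closed del: hom_mult)
    qed
    show ?thesis
    proof
      assume ?L
      then obtain vs where vs: "length vs = n" "set vs \<subseteq> h ` G.sym_gens S" "h x \<otimes>\<^bsub>H\<^esub> H.word_prod vs = h y"
        unfolding sym by auto
      then obtain ws where "vs = map h ws" "set ws \<subseteq> G.sym_gens S"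
        using lists_image[of h "G.sym_gens S"] by (auto simp: lists_eq_set image_iff set_eq_iff)
      then show ?R using vs * by auto
    next
      assume ?R
      then obtain ws where "length ws = n" "set ws \<subseteq> G.sym_gens S" "x \<otimes>\<^bsub>G\<^esub> G.word_prod ws = y" by auto
      then show ?L
        unfolding sym using * by (intro exI[of _ "map h ws"]) auto
    qed
  qed
  then show ?thesis
    unfolding cayley_dist_def by simp
qed

section \<open>Hyperbolicity of trees of spaces\<close>

definition one_step :: "'x list \<Rightarrow> 'x list set" where
  "one_step M = insert M (range (\<lambda>t. M @ [t]))"

lemma one_step_cases: "L \<in> one_step M \<longleftrightarrow> L = M \<or> (\<exists>t. L = M @ [t])"
  by (auto simp: one_step_def)

text \<open>\<open>L\<close> and \<open>L'\<close> are edges at the vertex \<open>M\<close>. As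
  \<open>T\<close> is not a prefix of \<open>L\<close>, it is not one of \<open>M\<close> either, so
  \<open>L'\<close> must be a proper extension of \<open>M\<close> by one entry and equal
  \<open>T\<close>: the part of the tree beyond \<open>T\<close> is entered only through
  \<open>T\<close>.\<close>

lemma prefix_one_step:
  assumes "L \<in> one_step M" "L' \<in> one_step M" "prefix T L'" "\<not> prefix T L"
  shows "L' = T"
  using assms by (auto simp: one_step_cases)

text \<open>
  \<open>N g\<close> codes the path in the Bass--Serre tree from the base vertex (the coset \<open>P True\<close>) up to
  and including the edge \<open>g A\<close>, so it is never empty.  A vertex is coded by the list \<open>M\<close> of edges
  leading to it; the edges at it are those with code \<open>M\<close> or \<open>M @ [t]\<close>, and the parity of the
  length of \<open>M\<close> tells cosets of \<open>P True\<close> and \<open>P False\<close> apart.\<close>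

locale tree_coding = group G for G (structure) +
  fixes P :: "bool \<Rightarrow> 'a set" and A :: "'a set" and S :: "bool \<Rightarrow> 'a set"
    and N :: "'a \<Rightarrow> 'x list"
  assumes P_subgroup: "subgroup (P i) G"
    and A_sub_S: "A \<subseteq> S i"
    and gen_P: "generate G (S i) = P i"
    and gen_G: "generate G (S True \<union> S False) = carrier G"
    and N_eqD: "\<lbrakk>q \<in> carrier G; q' \<in> carrier G; N q = N q'\<rbrakk> \<Longrightarrow> inv q \<otimes> q' \<in> A"
    and N_coset: "\<lbrakk>q \<in> carrier G; q' \<in> carrier G\<rbrakk> \<Longrightarrow>
      inv q \<otimes> q' \<in> P i \<longleftrightarrow> (\<exists>M. even (length M) = i \<and> N q \<in> one_step M \<and> N q' \<in> one_step M)"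
    and N_nonempty: "q \<in> carrier G \<Longrightarrow> N q \<noteq> []"
    and N_one: "length (N \<one>) = 1"
begin

definition gens :: "'a set" where "gens = S True \<union> S False"

lemma P_closed: "P i \<subseteq> carrier G"
  using P_subgroup subgroup.subset by blast

lemma S_sub_P: "S i \<subseteq> P i"
  using generate.incl[of _ "S i" G] gen_P[of i] by auto

lemma S_closed: "S i \<subseteq> carrier G"
  using S_sub_P P_closed by blast

lemma gens_closed: "gens \<subseteq> carrier G"
  using S_closed by (auto simp: gens_def)

lemma generate_gens: "generate G gens = carrier G"
  using gen_G by (simp add: gens_def)

lemma S_sub_gens: "S i \<subseteq> gens"
  by (cases i) (auto simp: gens_def)

abbreviation D :: "'a \<Rightarrow> 'a \<Rightarrow> real" where
  "D x y \<equiv> real (cayley_dist G gens x y)"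

lemma D_commute: "x \<in> carrier G \<Longrightarrow> y \<in> carrier G \<Longrightarrow> D x y = D y x"
  using cayley_dist_commute[OF gens_closed] generate_gens by simp

lemma D_triangle:
  "x \<in> carrier G \<Longrightarrow> y \<in> carrier G \<Longrightarrow> z \<in> carrier G \<Longrightarrow> D x z \<le> D x y + D y z"
  using cayley_dist_triangle[OF gens_closed, of x y z] generate_gens by (simp flip: of_nat_add)

lemma D_translate:
  "g \<in> carrier G \<Longrightarrow> x \<in> carrier G \<Longrightarrow> y \<in> carrier G \<Longrightarrow> D (g \<otimes> x) (g \<otimes> y) = D x y"
  using cayley_dist_translate[OF gens_closed] by simp

section \<open>Separation of the Cayley graph by the cosets of \<open>A\<close>\<close>

lemma D_same_coset:
  assumes "x \<in> carrier G" "y \<in> carrier G" "N x = N y"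
  shows "D x y \<le> 1"
  using cayley_dist_gen_le[OF gens_closed assms(1,2)] N_eqD[OF assms] A_sub_S S_sub_gens by force

lemma sym_gens_cases:
  assumes "s \<in> sym_gens gens"
  obtains i where "s \<in> P i" "s \<in> sym_gens (S i)"
proof -
  obtain i where "s \<in> sym_gens (S i)"
    using assms by (auto simp: gens_def)
  moreover have "s \<in> P i"
    using calculation S_sub_P subgroup.m_inv_closed[OF P_subgroup] by auto
  ultimately show ?thesis using that by blast
qed

text \<open>A generator lies in some \<open>P i\<close>, so an edge of the Cayley graph stays inside
  one vertex coset, and the tree edges of its two ends meet at that vertex.\<close>

lemma N_step:
  assumes "g \<in> carrier G" "s \<in> sym_gens gens"
  obtains M where "N g \<in> one_step M" "N (g \<otimes> s) \<in> one_step M"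
proof -
  obtain i where i: "s \<in> P i" using sym_gens_cases assms by metis
  then have s: "s \<in> carrier G" using P_closed by auto
  then have "inv g \<otimes> (g \<otimes> s) = s"
    using assms by (simp flip: m_assoc)
  then show ?thesis
    using N_coset[of g "g \<otimes> s" i] i s assms that by auto
qed

text \<open>A discrete intermediate value argument: codes change by one tree step per letter, so by
  \<open>prefix_one_step\<close> the first point whose code extends \<open>T\<close> has code
  exactly \<open>T\<close>.\<close>

lemma path_hits_prefix:
  assumes "x \<in> carrier G" "set ws \<subseteq> sym_gens gens" "\<not> prefix T (N x)"
    "prefix T (N (x \<otimes> word_prod ws))"
  shows "\<exists>u v. ws = u @ v \<and> N (x \<otimes> word_prod u) = T"
  using assms
proof (induction ws arbitrary: x)
  case Nil
  then show ?case by simp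
next
  case (Cons s ws)
  have sC: "s \<in> carrier G" and wC: "word_prod ws \<in> carrier G"
    using Cons.prems sym_gens_closed[OF gens_closed] word_prod_closed[of ws] by auto
  then have assoc: "x \<otimes> s \<otimes> word_prod ws = x \<otimes> word_prod (s # ws)"
    using Cons.prems by (simp add: m_assoc)
  show ?case
  proof (cases "prefix T (N (x \<otimes> s))")
    case True
    obtain M where "N x \<in> one_step M" "N (x \<otimes> s) \<in> one_step M"
      using N_step[of x s] Cons.prems by auto
    then have "N (x \<otimes> s) = T"
      using prefix_one_step True Cons.prems(3) by blast
    then show ?thesis
      using sC by (intro exI[of _ "[s]"] exI[of _ ws]) auto
  next
    case False
    then obtain u v where uv: "ws = u @ v" "N (x \<otimes> s \<otimes> word_prod u) = T"
      using Cons.IH[of "x \<otimes> s"] Cons.prems sC assoc by auto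
    moreover have "set u \<subseteq> carrier G"
      using uv(1) Cons.prems(2) order_trans[OF _ sym_gens_closed[OF gens_closed], of "set u"] by simp
    then have "word_prod u \<in> carrier G" by (rule word_prod_closed)
    ultimately show ?thesis
      using sC Cons.prems(1) by (intro exI[of _ "s # u"] exI[of _ v]) (auto simp: m_assoc)
  qed
qed

text \<open>A shortest word is cut at the point supplied by \<open>path_hits_prefix\<close>; the
  lengths of the two pieces bound the two distances.\<close>

lemma D_hit:
  assumes "x \<in> carrier G" "y \<in> carrier G" "\<not> prefix T (N x)" "prefix T (N y)"
  obtains q where "q \<in> carrier G" "N q = T" "D x q + D q y \<le> D x y"
proof -
  obtain ws where ws: "length ws = cayley_dist G gens x y" "set ws \<subseteq> sym_gens gens"
    "x \<otimes> word_prod ws = y"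
    using cayley_dist_word[OF gens_closed assms(1,2)] assms generate_gens by auto
  then obtain u v where uv: "ws = u @ v" "N (x \<otimes> word_prod u) = T"
    using path_hits_prefix assms by metis
  have C: "set u \<subseteq> carrier G" "set v \<subseteq> carrier G"
    using uv ws sym_gens_closed[OF gens_closed] by auto
  define q where "q = x \<otimes> word_prod u"
  have "q \<otimes> word_prod v = y"
    using ws(3) uv(1) C assms(1) unfolding q_def
    by (simp add: word_prod_append word_prod_closed m_assoc del: foldr_append)
  then have "cayley_dist G gens x q \<le> length u" "cayley_dist G gens q y \<le> length v"
    using ws(2) uv(1) q_def by (auto intro!: cayley_dist_le)
  then have "D x q + D q y \<le> D x y"
    using ws(1) uv(1) by simp
  then show ?thesis
    using that[of q] uv C assms(1) q_def by (simp add: word_prod_closed)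
qed

text \<open>A geodesic crossing from one side to the other meets a point \<open>q\<close> with the
  code of \<open>e\<close>. Such a \<open>q\<close> is within distance 1 of \<open>e\<close>, and
  replacing it by \<open>e\<close> costs 1 on each side. An end point that itself has the code of
  \<open>e\<close> serves equally well as \<open>q\<close>.\<close>

lemma D_through:
  assumes "x \<in> carrier G" "y \<in> carrier G" "e \<in> carrier G"
    and sep: "prefix (N e) (N x) \<noteq> prefix (N e) (N y) \<or> N x = N e \<or> N y = N e"
  shows "D x e + D e y \<le> D x y + 2"
proof -
  have via: "D x e + D e y \<le> D x y + 2"
    if xy: "x \<in> carrier G" "y \<in> carrier G" and q: "q \<in> carrier G" "N q = N e" "D x q + D q y \<le> D x y" for x y q
  proof -
    have "D q e \<le> 1" "D e q \<le> 1"
      using D_same_coset[of q e] D_same_coset[of e q] q assms(3) by auto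
    then show ?thesis
      using D_triangle[of x q e] D_triangle[of e q y] xy q assms(3) by linarith
  qed
  consider "\<not> prefix (N e) (N x)" "prefix (N e) (N y)" | "\<not> prefix (N e) (N y)" "prefix (N e) (N x)"
    | "N x = N e" | "N y = N e"
    using sep by blast
  then show ?thesis
  proof cases
    case 1
    then obtain q where "q \<in> carrier G" "N q = N e" "D x q + D q y \<le> D x y"
      using D_hit[OF assms(1,2)] by metis
    then show ?thesis using via assms by metis
  next
    case 2
    then obtain q where "q \<in> carrier G" "N q = N e" "D y q + D q x \<le> D y x"
      using D_hit[OF assms(2,1)] by metis
    then have "D y e + D e x \<le> D y x + 2" using via assms by metis
    then show ?thesis using D_commute assms by simp
  next
    case 3
    then show ?thesis using D_same_coset[of x e] D_triangle[of e x y] D_commute[of x e] assms by simp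
  next
    case 4
    then show ?thesis using D_same_coset[of y e] D_triangle[of x y e] D_commute[of y e] assms by simp
  qed
qed

lemma N_one_prefix: "prefix T (N \<one>) \<Longrightarrow> T \<noteq> [] \<Longrightarrow> T = N \<one>"
  using N_one by (cases "N \<one>") (auto simp: prefix_Cons)

text \<open>A path from \<open>\<one>\<close> to \<open>x\<close> has to cross every edge on the
  tree path to \<open>x\<close>, so each nonempty prefix of a code is again the code of an
  element.\<close>

lemma prefix_realised:
  assumes "x \<in> carrier G" "prefix T (N x)" "T \<noteq> []"
  shows "\<exists>e\<in>carrier G. N e = T"
proof (cases "prefix T (N \<one>)")
  case True
  then show ?thesis using N_one_prefix assms(3) by auto
next
  case False
  then show ?thesis using D_hit[of \<one> x T] assms by blast
qed

lemma D_one_through: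
  assumes "x \<in> carrier G" "e \<in> carrier G" "prefix (N e) (N x)"
  shows "D \<one> e + D e x \<le> D \<one> x + 2"
proof (rule D_through)
  show "prefix (N e) (N \<one>) \<noteq> prefix (N e) (N x) \<or> N \<one> = N e \<or> N x = N e"
    using assms N_one_prefix N_nonempty by metis
qed (use assms in auto)

section \<open>Isometric embedding of the vertex groups\<close>

text \<open>The code of the vertex \<open>P i\<close>: the base vertex has the empty code, and the
  edge \<open>N \<one>\<close> leads from it to the vertex \<open>P False\<close>.\<close>

definition root :: "bool \<Rightarrow> 'x list" where
  "root i = (if i then [] else N \<one>)"

lemma mem_P_iff:
  assumes "q \<in> carrier G"
  shows "q \<in> P i \<longleftrightarrow> N q \<in> one_step (root i)"
proof -
  obtain t where t: "N \<one> = [t]"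
    using N_one by (auto simp: length_Suc_conv)
  \<comment> \<open>\<open>[t]\<close> lies in \<open>one_step M\<close> only for
    \<open>M = []\<close> and \<open>M = [t]\<close>, and the parity of the length tells these two
    apart.\<close>
  have M: "even (length M) = i \<and> N \<one> \<in> one_step M \<longleftrightarrow> M = root i" for M
    using t by (cases M rule: rev_cases) (auto simp: one_step_cases root_def Cons_eq_append_conv)
  have "q \<in> P i \<longleftrightarrow> (\<exists>M. even (length M) = i \<and> N \<one> \<in> one_step M \<and> N q \<in> one_step M)"
    using N_coset[of \<one> q i] assms by simp
  then show ?thesis
    using M by metis
qed

text \<open>The only edge incident to both root vertices is \<open>N \<one>\<close>.\<close>

lemma P_inter: "g \<in> P i \<Longrightarrow> g \<in> P (\<not> i) \<Longrightarrow> g \<in> A"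
proof -
  assume g: "g \<in> P i" "g \<in> P (\<not> i)"
  then have gC: "g \<in> carrier G" using P_closed by auto
  have "N g \<in> one_step (root True)" "N g \<in> one_step (root False)"
    using g mem_P_iff[OF gC] by (cases i; auto)+
  then have "N \<one> = N g"
    using N_one by (auto simp: one_step_cases root_def)
  then show "g \<in> A"
    using N_eqD[of \<one> g] gC by simp
qed

text \<open>The edge at the vertex \<open>root i\<close> through which \<open>L\<close> is seen from
  there: the first edge after \<open>root i\<close> if \<open>L\<close> extends it further, and
  otherwise \<open>root i\<close> itself, the edge towards the base vertex.\<close>

definition gate :: "bool \<Rightarrow> 'x list \<Rightarrow> 'x list" where
  "gate i L = (if prefix (root i) L then take (Suc (length (root i))) L else root i)"

lemma gate_one_step: "L \<in> one_step (root i) \<Longrightarrow> gate i L = L"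
  by (auto simp: gate_def one_step_cases)

text \<open>Moving around a vertex other than \<open>root i\<close> does not change the edge through
  which one is seen from \<open>root i\<close>.\<close>

lemma gate_eq:
  assumes "L \<in> one_step M" "L' \<in> one_step M" "M \<noteq> root i"
  shows "gate i L = gate i L'"
proof -
  have "gate i L = gate i M" if "L \<in> one_step M" for L
  proof -
    from that consider "L = M" | t where "L = M @ [t]" by (auto simp: one_step_cases)
    then show ?thesis
    proof cases
      case 2
      show ?thesis
      proof (cases "prefix (root i) M")
        case True
        then have "strict_prefix (root i) M" using assms(3) by (auto simp: strict_prefix_def)
        then have "length (root i) < length M" by (rule prefix_length_less)
        then show ?thesis using True 2 by (simp add: gate_def)
      next
        case False
        \<comment> \<open>Here \<open>M @ [t]\<close> may equal \<open>root i\<close>; both branches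
          of \<open>gate\<close> then yield \<open>root i\<close>.\<close>
        then show ?thesis using 2 by (auto simp: gate_def)
      qed
    qed simp
  qed
  then show ?thesis using assms by metis
qed

text \<open>A path that leaves \<^term>\<open>P i\<close> can return only through the coset of \<^term>\<open>A\<close> by which it
  left, and such an excursion can be replaced by a single edge.  Hence \<^term>\<open>P i\<close> is
  isometrically embedded.\<close>

lemma word_shadow:
  assumes "set ws \<subseteq> sym_gens gens" "g = word_prod ws"
  shows "\<exists>a\<in>P i. N a = gate i (N g) \<and>
    (if g \<in> P i then a = g \<and> cayley_dist G (S i) \<one> a \<le> length ws
     else Suc (cayley_dist G (S i) \<one> a) \<le> length ws)"
  using assms
proof (induction ws arbitrary: g rule: rev_induct)
  case Nil
  have "\<one> \<in> P i" using P_subgroup subgroup.one_closed by blast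
  moreover have "cayley_dist G (S i) \<one> \<one> \<le> 0"
    using cayley_dist_le[of "[]" "S i" \<one> \<one>] by simp
  ultimately show ?case
    using Nil mem_P_iff[of \<one> i] by (auto intro!: bexI[of _ \<one>] simp: gate_one_step)
next
  case (snoc s ws)
  define g' where "g' = word_prod ws"
  have C: "g' \<in> carrier G" "s \<in> carrier G"
    using snoc.prems sym_gens_closed[OF gens_closed] word_prod_closed[of ws] by (auto simp: g'_def)
  have "set ws \<subseteq> carrier G"
    using snoc.prems sym_gens_closed[OF gens_closed] by auto
  then have g: "g = g' \<otimes> s"
    using snoc.prems C by (simp add: word_prod_append g'_def del: foldr_append)
  have gC: "g \<in> carrier G" using C g by simp
  \<comment> \<open>\<open>a\<close> is the shadow of \<open>g'\<close>: the point \<open>g'\<close>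
    itself inside \<open>P i\<close>, and otherwise the point from which the walk last left
    \<open>P i\<close>.\<close>
  obtain a where a: "a \<in> P i" "N a = gate i (N g')"
    "if g' \<in> P i then a = g' \<and> cayley_dist G (S i) \<one> a \<le> length ws
     else Suc (cayley_dist G (S i) \<one> a) \<le> length ws"
    using snoc.IH[OF _ g'_def] snoc.prems by auto
  have aC: "a \<in> carrier G" using a P_closed by auto
  have step: "cayley_dist G (S i) \<one> b \<le> Suc (cayley_dist G (S i) \<one> a)"
    if "b \<in> P i" "inv a \<otimes> b \<in> sym_gens (S i)" for b
  proof -
    have bC: "b \<in> carrier G" using that P_closed by auto
    have "a \<otimes> (inv a \<otimes> b) = b" using aC bC by (simp flip: m_assoc)
    then have "cayley_dist G (S i) a b \<le> 1"
      using cayley_dist_le[of "[inv a \<otimes> b]" "S i" a b] that aC bC by simp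
    moreover have "inv a \<otimes> b \<in> generate G (S i)"
      using that gen_P a P_subgroup subgroup.m_closed subgroup.m_inv_closed by metis
    ultimately show ?thesis
      using cayley_dist_triangle[OF S_closed[of i], of \<one> a b] aC bC a gen_P by simp
  qed
  show ?case
  proof (cases "g' \<in> P i \<and> g \<in> P i")
    case True
    have "inv g' \<otimes> g = s" using g C by (simp flip: m_assoc)
    then have "s \<in> P i"
      using True P_subgroup subgroup.m_closed subgroup.m_inv_closed by metis
    moreover obtain j where j: "s \<in> P j" "s \<in> sym_gens (S j)"
      using sym_gens_cases[of s] snoc.prems by auto
    ultimately have "s \<in> sym_gens (S i)"
    proof (cases "j = i")
      case False
      \<comment> \<open>The letter is a generator of the other factor but lies in
        \<open>P i\<close>, so up to inversion it belongs to \<open>A\<close> and hence also to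
        \<open>S i\<close>.\<close>
      then have ji: "(\<not> j) = i" by auto
      have "inv s \<in> P i" using \<open>s \<in> P i\<close> P_subgroup subgroup.m_inv_closed by metis
      have "s \<in> S j \<or> inv s \<in> S j"
        using j S_closed[of j] by auto
      then have "s \<in> A \<or> inv s \<in> A"
        using P_inter[of _ j] S_sub_P[of j] \<open>s \<in> P i\<close> \<open>inv s \<in> P i\<close> unfolding ji by blast
      then have "s \<in> S i \<or> inv s \<in> S i"
        using A_sub_S by blast
      then show ?thesis
        using C(2) by (metis UnI1 UnI2 image_eqI inv_inv)
    qed (use j in simp)
    moreover have "a = g'" "cayley_dist G (S i) \<one> a \<le> length ws"
      using a(3) True by auto
    ultimately have "cayley_dist G (S i) \<one> g \<le> length (ws @ [s])"
      using step[of g] True \<open>inv g' \<otimes> g = s\<close> by simp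
    then show ?thesis
      using True mem_P_iff[OF gC] by (intro bexI[of _ g]) (auto simp: gate_one_step)
  next
    case False
    \<comment> \<open>One of \<open>g'\<close>, \<open>g\<close> is outside \<open>P i\<close>, so
      this letter moves around a vertex other than \<open>root i\<close> and the gate is
      unchanged.\<close>
    obtain M where M: "N g' \<in> one_step M" "N g \<in> one_step M"
      using N_step[of g' s] C g snoc.prems by auto
    then have "M \<noteq> root i"
      using False mem_P_iff C gC by blast
    then have gate: "gate i (N g') = gate i (N g)"
      using gate_eq M by blast
    show ?thesis
    proof (cases "g \<in> P i")
      case True
      \<comment> \<open>The walk returns through the coset by which it left, so \<open>g\<close>
        differs from the old shadow by an element of \<open>A\<close>, which is a single edge over
        \<open>S i\<close>.\<close>
      then have "N a = N g"
        using a gate mem_P_iff[OF gC] by (simp add: gate_one_step)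
      then have "inv a \<otimes> g \<in> sym_gens (S i)"
        using N_eqD[OF aC gC] A_sub_S by blast
      then have "cayley_dist G (S i) \<one> g \<le> length (ws @ [s])"
        using step[of g] True a False by simp
      then show ?thesis
        using True mem_P_iff[OF gC] by (intro bexI[of _ g]) (auto simp: gate_one_step)
    next
      case False
      then show ?thesis
        using a gate by (intro bexI[of _ a]) (auto split: if_splits)
    qed
  qed
qed

text \<open>After translating \<open>x\<close> to \<open>\<one>\<close>, \<open>word_shadow\<close>
  applied to a shortest word over \<open>gens\<close> gives one inequality; the other holds because
  \<open>gens\<close> contains \<open>S i\<close>.\<close>

lemma D_P:
  assumes "x \<in> P i" "y \<in> P i"
  shows "D x y = real (cayley_dist G (S i) x y)"
proof -
  have C: "x \<in> carrier G" "y \<in> carrier G" using assms P_closed by auto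
  define g where "g = inv x \<otimes> y"
  have gP: "g \<in> P i"
    using assms P_subgroup subgroup.m_closed subgroup.m_inv_closed unfolding g_def by metis
  have gC: "g \<in> carrier G" using gP P_closed by auto
  have "y = x \<otimes> g"
    using C by (simp add: g_def flip: m_assoc)
  then have shift: "cayley_dist G Z x y = cayley_dist G Z \<one> g" if "Z \<subseteq> carrier G" for Z
    using cayley_dist_translate[OF that, of x \<one> g] C gC by simp
  obtain ws where ws: "length ws = cayley_dist G gens \<one> g" "set ws \<subseteq> sym_gens gens"
    "\<one> \<otimes> word_prod ws = g"
    using cayley_dist_word[OF gens_closed, of \<one> g] gC generate_gens by auto
  have "word_prod ws = g"
    using ws word_prod_closed[of ws] sym_gens_closed[OF gens_closed] by auto
  then have "cayley_dist G (S i) \<one> g \<le> cayley_dist G gens \<one> g"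
    using word_shadow[OF ws(2), of g i] gP ws(1) by auto
  moreover have "cayley_dist G gens \<one> g \<le> cayley_dist G (S i) \<one> g"
    using cayley_dist_antimono[OF S_sub_gens gens_closed, of \<one> g i] gC gP gen_P by simp
  ultimately show ?thesis
    using shift[OF gens_closed] shift[OF S_closed] by simp
qed

section \<open>Gromov products and the branching of tree paths\<close>

text \<open>No element has the empty code, so \<open>\<one>\<close> stands in as base point there.
  As \<open>rep\<close> depends on the code alone, elements with a common initial path share the
  very same base point.\<close>

definition rep :: "'x list \<Rightarrow> 'a" where
  "rep T = (if T = [] then \<one> else SOME e. e \<in> carrier G \<and> N e = T)"

lemma rep:
  assumes "x \<in> carrier G" "prefix T (N x)"
  shows "rep T \<in> carrier G" and "T \<noteq> [] \<Longrightarrow> N (rep T) = T"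
proof -
  have "T \<noteq> [] \<Longrightarrow> rep T \<in> carrier G \<and> N (rep T) = T"
    using someI_ex[of "\<lambda>e. e \<in> carrier G \<and> N e = T"] prefix_realised[OF assms]
    by (auto simp: rep_def)
  then show "rep T \<in> carrier G" and "T \<noteq> [] \<Longrightarrow> N (rep T) = T"
    by (auto simp: rep_def)
qed

text \<open>\<open>agree m x y\<close>: the tree geodesics from the root to \<open>x\<close> and \<open>y\<close> share their first
  \<open>m\<close> edges.\<close>

definition agree :: "nat \<Rightarrow> 'a \<Rightarrow> 'a \<Rightarrow> bool" where
  "agree m x y \<longleftrightarrow> m \<le> length (N x) \<and> m \<le> length (N y) \<and> take m (N x) = take m (N y)"

text \<open>\<open>base m x\<close> and \<open>base (Suc m) x\<close> are the points of entry to and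
  exit from the \<open>m\<close>-th vertex space on the way to \<open>x\<close>. Once
  \<open>m\<close> reaches the length of \<open>N x\<close>, the exit point merely has the code of
  \<open>x\<close>.\<close>

abbreviation base :: "nat \<Rightarrow> 'a \<Rightarrow> 'a" where "base m x \<equiv> rep (take m (N x))"

lemma base_closed: "x \<in> carrier G \<Longrightarrow> base m x \<in> carrier G"
  using rep(1)[of x "take m (N x)"] by (simp add: take_is_prefix)

lemma N_base: "x \<in> carrier G \<Longrightarrow> 0 < m \<Longrightarrow> N (base m x) = take m (N x)"
  using rep(2)[of x "take m (N x)"] N_nonempty by (simp add: take_is_prefix)

lemma base_one_step:
  assumes "x \<in> carrier G" "m \<le> length (N x)"
  shows "N (base (Suc m) x) \<in> one_step (take m (N x))"
  using assms N_base[of x "Suc m"]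
  by (cases "m < length (N x)") (auto simp: one_step_cases take_Suc_conv_app_nth)

text \<open>Entry and exit edge both meet the vertex coded by the common prefix of length
  \<open>m\<close>, and the parity of \<open>m\<close> selects the factor.\<close>

lemma base_in_coset:
  assumes "x \<in> carrier G" "y \<in> carrier G" "agree m x y"
  shows "inv (base m x) \<otimes> base (Suc m) y \<in> P (even m)"
proof -
  have m: "m \<le> length (N x)" "m \<le> length (N y)" "take m (N x) = take m (N y)"
    using assms(3) by (auto simp: agree_def)
  have y: "N (base (Suc m) y) \<in> one_step (take m (N x))"
    using base_one_step[OF assms(2) m(2)] m(3) by simp
  show ?thesis
  \<comment> \<open>For \<open>m = 0\<close> the entry point is \<open>\<one>\<close>, whose code is
    not the empty prefix, so the base vertex is treated separately.\<close>
  proof (cases "m = 0")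
    case True
    then have "base m x = \<one>" by (simp add: rep_def)
    moreover have "base (Suc m) y \<in> P True"
      using y True mem_P_iff[of "base (Suc m) y" True] base_closed[OF assms(2)]
      by (simp add: root_def)
    ultimately show ?thesis
      using True base_closed[OF assms(2)] by simp
  next
    case False
    then have "N (base m x) \<in> one_step (take m (N x))"
      using N_base[OF assms(1)] by (simp add: one_step_cases)
    moreover have "length (take m (N x)) = m" using m by simp
    ultimately show ?thesis
      using y N_coset[of "base m x" "base (Suc m) y" "even m"] base_closed assms by metis
  qed
qed

text \<open>Both base points lie in this order on the tree path to \<open>x\<close>;
  \<open>D_one_through\<close> is used twice, with a loss of 2 each time.\<close>

lemma D_one_lower:
  assumes "x \<in> carrier G"
  shows "D \<one> (base m x) + D (base m x) (base (Suc m) x) + D (base (Suc m) x) x \<le> D \<one> x + 4"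
proof -
  have C: "base m x \<in> carrier G" "base (Suc m) x \<in> carrier G" using assms base_closed by auto
  have 1: "D \<one> (base (Suc m) x) + D (base (Suc m) x) x \<le> D \<one> x + 2"
    using assms C by (intro D_one_through) (simp_all add: N_base take_is_prefix)
  have 2: "D \<one> (base m x) + D (base m x) (base (Suc m) x) \<le> D \<one> (base (Suc m) x) + 2"
  proof (cases "m = 0")
    case True
    then have "base m x = \<one>" by (simp add: rep_def)
    moreover have "D \<one> \<one> = 0" using cayley_dist_le[of "[]" gens \<one> \<one>] by simp
    ultimately show ?thesis by simp
  next
    case False
    have "take m (N x) = take m (take (Suc m) (N x))" by (simp add: min_def)
    then have "prefix (N (base m x)) (N (base (Suc m) x))"
      using N_base assms False take_is_prefix by (metis zero_less_Suc neq0_conv)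
    then show ?thesis
      using C by (intro D_one_through) auto
  qed
  from 1 2 show ?thesis by linarith
qed

text \<open>The triangle inequality bounds \<open>D x y\<close> through the two exit points, while
  \<open>D_one_lower\<close> costs 4 for each of \<open>x\<close> and \<open>y\<close>; halving
  leaves an error of 4.\<close>

lemma gromov_product_lower:
  assumes "x \<in> carrier G" "y \<in> carrier G" "agree m x y"
  shows "gromov_product D \<one> x y \<ge>
    D \<one> (base m x) + gromov_product D (base m x) (base (Suc m) x) (base (Suc m) y) - 4"
proof -
  have eq: "base m y = base m x" using assms(3) by (simp add: agree_def)
  have C: "base m x \<in> carrier G" "base (Suc m) x \<in> carrier G" "base (Suc m) y \<in> carrier G"
    using assms base_closed by auto
  have "D x y \<le> D (base (Suc m) x) x + D (base (Suc m) x) (base (Suc m) y) + D (base (Suc m) y) y"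
    using D_triangle[of x "base (Suc m) x" y] D_triangle[of "base (Suc m) x" "base (Suc m) y" y]
      D_commute[of x "base (Suc m) x"] assms C by linarith
  then show ?thesis
    using D_one_lower[OF assms(1), of m] D_one_lower[OF assms(2), of m]
      D_commute[of x \<one>] D_commute[of y \<one>]
      D_commute[of "base (Suc m) x" "base m x"] D_commute[of "base (Suc m) y" "base m x"] assms C
    unfolding gromov_product_def eq by (simp add: field_simps)
qed

text \<open>Since the paths branch after exactly \<open>m\<close> edges, the exit cosets separate
  \<open>x\<close> from \<open>y\<close>. \<open>D_through\<close> at both exits bounds
  \<open>D x y\<close> from below with a loss of 4, halved in the product.\<close>

lemma gromov_product_upper:
  assumes "x \<in> carrier G" "y \<in> carrier G" "agree m x y" "\<not> agree (Suc m) x y"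
  shows "gromov_product D \<one> x y \<le>
    D \<one> (base m x) + gromov_product D (base m x) (base (Suc m) x) (base (Suc m) y) + 2"
proof -
  define p where "p = base m x"
  define q where "q = base (Suc m) x"
  define r where "r = base (Suc m) y"
  have C: "p \<in> carrier G" "q \<in> carrier G" "r \<in> carrier G"
    using assms base_closed by (auto simp: p_def q_def r_def)
  have N: "N q = take (Suc m) (N x)" "N r = take (Suc m) (N y)"
    using assms N_base by (auto simp: q_def r_def)
  have m: "m \<le> length (N x)" "m \<le> length (N y)" "take m (N x) = take m (N y)"
    using assms(3) by (auto simp: agree_def)
  \<comment> \<open>If the code of \<open>x\<close> ends at length \<open>m\<close>, the exit point
    \<open>q\<close> has the code of \<open>x\<close>, a case that \<open>D_through\<close> admits;
    likewise for \<open>y\<close> and \<open>r\<close>.\<close>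
  have pq: "N q = N x" if "length (N x) = m" using that N by simp
  have pr: "N r = N y" if "length (N y) = m" using that N by simp
  have "\<not> prefix (N q) (N y)" if "length (N x) \<noteq> m"
  proof
    assume "prefix (N q) (N y)"
    then have "take (Suc m) (N x) = take (Suc m) (N y)" "Suc m \<le> length (N y)"
      using N that m by (auto simp: prefix_def)
    then show False using assms(4) that m by (auto simp: agree_def)
  qed
  moreover have "prefix (N q) (N x)" by (simp add: N take_is_prefix)
  ultimately have 1: "D x q + D q y \<le> D x y + 2"
    using pq C assms(1,2) by (intro D_through) metis+
  have "\<not> prefix (N r) (N q)" if "length (N y) \<noteq> m"
  proof
    assume "prefix (N r) (N q)"
    then have "prefix (N r) (N x)" using N take_is_prefix prefix_order.trans by metis
    then have "take (Suc m) (N x) = take (Suc m) (N y)" "Suc m \<le> length (N x)"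
      using N that m by (auto simp: prefix_def)
    then show False using assms(4) that m by (auto simp: agree_def)
  qed
  moreover have "prefix (N r) (N y)" by (simp add: N take_is_prefix)
  ultimately have 2: "D q r + D r y \<le> D q y + 2"
    using pr C assms(1,2) by (intro D_through) metis+
  have "D \<one> x \<le> D \<one> p + D p q + D q x" "D \<one> y \<le> D \<one> p + D p r + D r y"
    using D_triangle[of \<one> p x] D_triangle[of p q x] D_triangle[of \<one> p y] D_triangle[of p r y] assms C
    by auto
  then have "gromov_product D \<one> x y \<le> D \<one> p + gromov_product D p q r + 2"
    using 1 2 D_commute[of x \<one>] D_commute[of y \<one>] D_commute[of q p] D_commute[of r p]
      D_commute[of x q] assms C
    unfolding gromov_product_def by (simp add: field_simps)
  then show ?thesis by (simp add: p_def q_def r_def)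
qed

text \<open>Let \<open>m\<close> be maximal such that all three paths share \<open>m\<close> edges.
  The products are then compared inside one vertex space; the constant 6 is the sum of the errors 4
  and 2 of the lower and upper estimates.\<close>

lemma hyperbolic_at_one:
  assumes hyp: "\<And>i x y z w. \<lbrakk>x \<in> P i; y \<in> P i; z \<in> P i; w \<in> P i\<rbrakk> \<Longrightarrow>
      gromov_product D w x z \<ge> min (gromov_product D w x y) (gromov_product D w y z) - \<delta>"
    and "0 \<le> \<delta>" and C: "x \<in> carrier G" "y \<in> carrier G" "z \<in> carrier G"
  shows "gromov_product D \<one> x z \<ge> min (gromov_product D \<one> x y) (gromov_product D \<one> y z) - (\<delta> + 6)"
proof -
  define m where "m = (GREATEST m. agree m x y \<and> agree m y z)"
  have "agree 0 x y \<and> agree 0 y z" by (simp add: agree_def)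
  moreover have bd: "\<And>k. agree k x y \<and> agree k y z \<Longrightarrow> k \<le> length (N x)" by (simp add: agree_def)
  ultimately have m: "agree m x y \<and> agree m y z"
    unfolding m_def by (rule GreatestI_nat)
  \<comment> \<open>By maximality at least one of the pairs \<open>x\<close>, \<open>y\<close> and
    \<open>y\<close>, \<open>z\<close> branches at \<open>m\<close>. If the other pair stays
    together, its two exit points coincide and no hyperbolicity is required.\<close>
  have "\<not> (agree (Suc m) x y \<and> agree (Suc m) y z)"
    using Greatest_le_nat[of "\<lambda>m. agree m x y \<and> agree m y z" "Suc m", OF _ bd]
    unfolding m_def by auto
  then consider "\<not> agree (Suc m) x y" "\<not> agree (Suc m) y z" | "agree (Suc m) x y" "\<not> agree (Suc m) y z"
    | "\<not> agree (Suc m) x y" "agree (Suc m) y z" by blast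
  note cs = this
  have xx: "agree m x x" and xz: "agree m x z" and p: "base m y = base m x" "base m z = base m x"
    using m by (auto simp: agree_def)
  define b where "b = base m x"
  define q where "q = base (Suc m)"
  have qC: "b \<in> carrier G" "q x \<in> carrier G" "q y \<in> carrier G" "q z \<in> carrier G"
    using base_closed C by (auto simp: b_def q_def)
  have low: "gromov_product D \<one> x z \<ge> D \<one> b + gromov_product D b (q x) (q z) - 4"
    using gromov_product_lower[OF C(1,3) xz] by (simp add: b_def q_def)
  have up: "\<not> agree (Suc m) x y \<Longrightarrow> gromov_product D \<one> x y \<le> D \<one> b + gromov_product D b (q x) (q y) + 2"
    "\<not> agree (Suc m) y z \<Longrightarrow> gromov_product D \<one> y z \<le> D \<one> b + gromov_product D b (q y) (q z) + 2"
    using gromov_product_upper[OF C(1,2), of m] gromov_product_upper[OF C(2,3), of m] m p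
    by (auto simp: b_def q_def)
  from cs show ?thesis
  proof cases
    case 1
    have in_P: "inv b \<otimes> q x \<in> P (even m)" "inv b \<otimes> q y \<in> P (even m)" "inv b \<otimes> q z \<in> P (even m)"
      using base_in_coset[OF C(1,1) xx] base_in_coset[OF C(1,2) conjunct1[OF m]]
        base_in_coset[OF C(1,3) xz]
      by (simp_all add: b_def q_def)
    \<comment> \<open>Translation by \<open>inv b\<close> moves the vertex space onto the subgroup
      \<open>P (even m)\<close>, where \<open>hyp\<close> applies.\<close>
    have tr: "gromov_product D b u v = gromov_product D \<one> (inv b \<otimes> u) (inv b \<otimes> v)"
      if "u \<in> carrier G" "v \<in> carrier G" for u v
      using D_translate[of "inv b" u v] D_translate[of "inv b" u b] D_translate[of "inv b" v b] that qC
      by (simp add: gromov_product_def)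
    have "\<one> \<in> P (even m)" using P_subgroup subgroup.one_closed by blast
    then have "gromov_product D b (q x) (q z) \<ge>
      min (gromov_product D b (q x) (q y)) (gromov_product D b (q y) (q z)) - \<delta>"
      using hyp[OF in_P] tr qC by simp
    then show ?thesis using low up 1 by linarith
  next
    case 2
    then have "q x = q y" by (auto simp: agree_def q_def)
    then have "gromov_product D b (q x) (q z) = gromov_product D b (q y) (q z)" by simp
    then show ?thesis using low up(2)[OF 2(2)] \<open>0 \<le> \<delta>\<close> by linarith
  next
    case 3
    then have "q y = q z" by (auto simp: agree_def q_def)
    then have "gromov_product D b (q x) (q z) = gromov_product D b (q x) (q y)" by simp
    then show ?thesis using low up(1)[OF 3(1)] \<open>0 \<le> \<delta>\<close> by linarith
  qed
qed

text \<open>\<open>D_P\<close> turns the hypothesis into one about \<open>D\<close> on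
  \<open>P i\<close>, and left translation moves an arbitrary base point \<open>w\<close> to
  \<open>\<one>\<close>.\<close>

theorem gromov_hyperbolic_amalgam:
  assumes hyp: "\<And>i. gromov_hyperbolic (P i) (\<lambda>x y. real (cayley_dist G (S i) x y))"
  shows "gromov_hyperbolic (carrier G) D"
proof -
  have "\<exists>\<delta>. \<forall>x\<in>P i. \<forall>y\<in>P i. \<forall>z\<in>P i. \<forall>w\<in>P i.
      gromov_product D w x z \<ge> min (gromov_product D w x y) (gromov_product D w y z) - \<delta>" for i
    using hyp[of i] unfolding gromov_hyperbolic_def gromov_product_def by (simp add: D_P cong: ball_cong)
  then obtain \<delta> where \<delta>: "\<And>i x y z w. \<lbrakk>x \<in> P i; y \<in> P i; z \<in> P i; w \<in> P i\<rbrakk> \<Longrightarrow>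
      gromov_product D w x z \<ge> min (gromov_product D w x y) (gromov_product D w y z) - \<delta> i"
    by metis
  define d where "d = max 0 (max (\<delta> True) (\<delta> False))"
  have d: "gromov_product D w x z \<ge> min (gromov_product D w x y) (gromov_product D w y z) - d"
    if "x \<in> P i" "y \<in> P i" "z \<in> P i" "w \<in> P i" for i x y z w
  proof -
    have "\<delta> i \<le> d" by (cases i) (auto simp: d_def)
    then show ?thesis using \<delta>[OF that] by linarith
  qed
  have "gromov_product D w x z \<ge> min (gromov_product D w x y) (gromov_product D w y z) - (d + 6)"
    if C: "x \<in> carrier G" "y \<in> carrier G" "z \<in> carrier G" "w \<in> carrier G" for x y z w
  proof -
    have tr: "gromov_product D w u v = gromov_product D \<one> (inv w \<otimes> u) (inv w \<otimes> v)"
      if "u \<in> carrier G" "v \<in> carrier G" for u v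
      using D_translate[of "inv w" u v] D_translate[of "inv w" u w] D_translate[of "inv w" v w] that C
      by (simp add: gromov_product_def)
    have "gromov_product D \<one> (inv w \<otimes> x) (inv w \<otimes> z) \<ge> min (gromov_product D \<one> (inv w \<otimes> x) (inv w \<otimes> y))
        (gromov_product D \<one> (inv w \<otimes> y) (inv w \<otimes> z)) - (d + 6)"
      by (rule hyperbolic_at_one[OF d]) (use C in \<open>auto simp: d_def\<close>)
    then show ?thesis
      using C by (simp add: tr)
  qed
  then show ?thesis
    unfolding gromov_hyperbolic_def by blast
qed

end

section \<open>Normal forms in amalgamated products\<close>

text \<open>The coset \<open>A\<close> is represented by the identity, so that a trivial first
  letter is an admissible representative.\<close>

definition coset_rep :: "('a, 'b) monoid_scheme \<Rightarrow> 'a set \<Rightarrow> 'a \<Rightarrow> 'a" where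
  "coset_rep G A x =
    (if x \<in> A then \<one>\<^bsub>G\<^esub> else SOME t. t \<in> carrier G \<and> inv\<^bsub>G\<^esub> t \<otimes>\<^bsub>G\<^esub> x \<in> A)"

context group
begin

lemma coset_rep:
  assumes "subgroup A G" "x \<in> carrier G"
  shows coset_rep_closed: "coset_rep G A x \<in> carrier G"
    and coset_rep_rel: "inv (coset_rep G A x) \<otimes> x \<in> A"
proof -
  have "\<exists>t. t \<in> carrier G \<and> inv t \<otimes> x \<in> A"
    using assms by (intro exI[of _ x]) (simp add: subgroup.one_closed)
  from someI_ex[OF this] show "coset_rep G A x \<in> carrier G" "inv (coset_rep G A x) \<otimes> x \<in> A"
    using assms by (auto simp: coset_rep_def)
qed

lemma subgroup_mult_cancel_right:
  assumes "subgroup A G" "a \<in> A" "x \<in> carrier G"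
  shows "x \<otimes> a \<in> A \<longleftrightarrow> x \<in> A"
proof
  have aC: "a \<in> carrier G" using assms subgroup.mem_carrier by metis
  assume "x \<otimes> a \<in> A"
  then have "x \<otimes> a \<otimes> inv a \<in> A"
    using assms subgroup.m_closed subgroup.m_inv_closed by metis
  then show "x \<in> A" using assms aC by (simp add: m_assoc)
qed (use assms subgroup.m_closed in metis)

text \<open>\<open>SOME\<close> is applied to the same predicate for \<open>x\<close> and
  \<open>x \<otimes> a\<close>, so the choice depends only on the coset.\<close>

lemma coset_rep_mult:
  assumes "subgroup A G" "a \<in> A" "x \<in> carrier G"
  shows "coset_rep G A (x \<otimes> a) = coset_rep G A x"
proof -
  have aC: "a \<in> carrier G" using assms subgroup.mem_carrier by metis
  have "inv t \<otimes> (x \<otimes> a) \<in> A \<longleftrightarrow> inv t \<otimes> x \<in> A" if "t \<in> carrier G" for t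
    using subgroup_mult_cancel_right[OF assms(1,2), of "inv t \<otimes> x"] that assms(3) aC
    by (simp add: m_assoc)
  then have "(\<lambda>t. t \<in> carrier G \<and> inv t \<otimes> (x \<otimes> a) \<in> A) = (\<lambda>t. t \<in> carrier G \<and> inv t \<otimes> x \<in> A)"
    by auto
  then show ?thesis
    using subgroup_mult_cancel_right[OF assms] by (simp add: coset_rep_def)
qed

lemma coset_rep_idem:
  assumes "subgroup A G" "x \<in> carrier G"
  shows "coset_rep G A (coset_rep G A x) = coset_rep G A x"
proof -
  let ?r = "coset_rep G A x"
  have "?r \<otimes> (inv ?r \<otimes> x) = x"
    using coset_rep_closed[OF assms] assms(2) by (simp flip: m_assoc)
  then show ?thesis
    using coset_rep_mult[OF assms(1) coset_rep_rel[OF assms] coset_rep_closed[OF assms]] by simp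
qed

lemma coset_rep_mem_iff:
  assumes "subgroup A G" "x \<in> carrier G"
  shows "coset_rep G A x \<in> A \<longleftrightarrow> x \<in> A"
proof -
  let ?r = "coset_rep G A x"
  have "?r \<otimes> (inv ?r \<otimes> x) = x"
    using coset_rep_closed[OF assms] assms(2) by (simp flip: m_assoc)
  then show ?thesis
    using subgroup_mult_cancel_right[OF assms(1) coset_rep_rel[OF assms] coset_rep_closed[OF assms]]
    by simp
qed

end

section \<open>The action of one factor on normal forms\<close>

lemma rev_one_step: "rev L \<in> one_step (rev M) \<longleftrightarrow> L = M \<or> (\<exists>t. L = t # M)"
  by (metis one_step_cases rev.simps(2) rev_rev_ident)

primrec path_value :: "('g, 'z) monoid_scheme \<Rightarrow> ('x \<Rightarrow> 'g) \<Rightarrow> 'x list \<Rightarrow> 'g" where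
  "path_value G \<kappa> [] = \<one>\<^bsub>G\<^esub>"
| "path_value G \<kappa> (x # M) = path_value G \<kappa> M \<otimes>\<^bsub>G\<^esub> \<kappa> x"

text \<open>
  Van der Waerden's trick, for one factor \<open>P\<close> of the amalgam.  A normal form
  \<open>t\<^sub>1 \<cdots> t\<^sub>n a\<close> is stored as the pair of the reversed list of coset representatives and of
  \<open>a\<close> in the abstract amalgamated group \<open>Q\<close>; position \<open>i\<close> belongs to the first factor iff
  \<open>i\<close> is odd, and only \<open>t\<^sub>1\<close> may be trivial.  Absorbing the last representative from \<open>P\<close>, if
  there is one, together with \<open>a\<close> into a single element of \<open>P\<close> identifies the normal forms with
  pairs of a list of the right parity and an element of \<open>P\<close>, on which \<open>P\<close> acts by
  right multiplication.\<close>

locale amalgam_side = P: group P + Q: group Q + G: group G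
  for P :: "('p, 'u) monoid_scheme" and Q :: "('q, 'v) monoid_scheme" and G :: "('g, 'w) monoid_scheme" +
  fixes B :: "'p set" and \<psi> :: "'q \<Rightarrow> 'p" and C :: "'p \<Rightarrow> 'x" and V :: "'x list set" and par :: bool
    and \<kappa> :: "'x \<Rightarrow> 'g" and \<iota> :: "'q \<Rightarrow> 'g"
  assumes B_subgroup: "subgroup B P"
    and psi_iso: "\<psi> \<in> iso Q (P\<lparr>carrier := B\<rparr>)"
    and inj_C: "inj C"
    and V_Cons: "C t # M \<in> V \<longleftrightarrow> M \<in> V \<and> even (length M) = par \<and> t \<in> carrier P \<and>
      coset_rep P B t = t \<and> (M \<noteq> [] \<longrightarrow> t \<notin> B)"
    and V_Cons_other: "x # M \<in> V \<Longrightarrow> x \<notin> range C \<Longrightarrow> even (length M) \<noteq> par"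
    and V_closed: "M \<in> V \<Longrightarrow> x \<in> set M \<Longrightarrow> \<kappa> x \<in> carrier G"
    and kappa_hom: "(\<lambda>p. \<kappa> (C p)) \<in> hom P G"
    and iota: "a \<in> carrier Q \<Longrightarrow> \<iota> a = \<kappa> (C (\<psi> a))"
begin

definition states :: "('x list \<times> 'q) set" where
  "states = {(L, a). L \<in> V \<and> L \<noteq> [] \<and> a \<in> carrier Q}"

definition split_states :: "('x list \<times> 'p) set" where
  "split_states = {(M, y). M \<in> V \<and> even (length M) = par \<and> y \<in> carrier P}"

definition split :: "'x list \<times> 'q \<Rightarrow> 'x list \<times> 'p" where
  "split = (\<lambda>(L, a). if hd L \<in> range C then (tl L, the_inv C (hd L) \<otimes>\<^bsub>P\<^esub> \<psi> a) else (L, \<psi> a))"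

text \<open>For empty \<open>M\<close> a representative is split off even when
  \<open>y \<in> B\<close>; it is then trivial, and the resulting list is never empty.\<close>

definition join :: "'x list \<times> 'p \<Rightarrow> 'x list \<times> 'q" where
  "join = (\<lambda>(M, y). if y \<in> B \<and> M \<noteq> [] then (M, the_inv_into (carrier Q) \<psi> y)
     else (C (coset_rep P B y) # M,
           the_inv_into (carrier Q) \<psi> (inv\<^bsub>P\<^esub> (coset_rep P B y) \<otimes>\<^bsub>P\<^esub> y)))"

definition shift :: "'p \<Rightarrow> 'x list \<times> 'q \<Rightarrow> 'x list \<times> 'q" where
  "shift x st = join (fst (split st), snd (split st) \<otimes>\<^bsub>P\<^esub> x)"

definition val :: "'x list \<times> 'q \<Rightarrow> 'g" where
  "val st = path_value G \<kappa> (fst st) \<otimes>\<^bsub>G\<^esub> \<iota> (snd st)"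

abbreviation "\<psi>' \<equiv> the_inv_into (carrier Q) \<psi>"

lemma psi_bij: "bij_betw \<psi> (carrier Q) B"
  using psi_iso by (simp add: iso_def)

lemma psi_in_B: "a \<in> carrier Q \<Longrightarrow> \<psi> a \<in> B"
  using psi_bij bij_betwE by blast

lemma B_closed: "b \<in> B \<Longrightarrow> b \<in> carrier P"
  using B_subgroup subgroup.mem_carrier by metis

lemma psi_closed: "a \<in> carrier Q \<Longrightarrow> \<psi> a \<in> carrier P"
  using psi_in_B B_closed by blast

lemma psi_mult: "a \<in> carrier Q \<Longrightarrow> b \<in> carrier Q \<Longrightarrow> \<psi> (a \<otimes>\<^bsub>Q\<^esub> b) = \<psi> a \<otimes>\<^bsub>P\<^esub> \<psi> b"
  using psi_iso by (simp add: iso_def hom_def)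

lemma psi'_psi: "a \<in> carrier Q \<Longrightarrow> \<psi>' (\<psi> a) = a"
  using psi_bij by (simp add: bij_betw_def the_inv_into_f_f)

lemma psi_psi': "b \<in> B \<Longrightarrow> \<psi> (\<psi>' b) = b"
  using psi_bij by (simp add: bij_betw_def f_the_inv_into_f)

lemma psi'_closed: "b \<in> B \<Longrightarrow> \<psi>' b \<in> carrier Q"
  using psi_bij by (metis bij_betw_def order_refl the_inv_into_into)

lemmas rep_closed = P.coset_rep_closed[OF B_subgroup]
lemmas rep_rel = P.coset_rep_rel[OF B_subgroup]

lemma rep_mult_rel: "y \<in> carrier P \<Longrightarrow> coset_rep P B y \<otimes>\<^bsub>P\<^esub> (inv\<^bsub>P\<^esub> (coset_rep P B y) \<otimes>\<^bsub>P\<^esub> y) = y"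
  using rep_closed by (simp flip: P.m_assoc)

lemma split_simps:
  "split (C t # M, a) = (M, t \<otimes>\<^bsub>P\<^esub> \<psi> a)"
  "hd L \<notin> range C \<Longrightarrow> split (L, a) = (L, \<psi> a)"
  by (auto simp: split_def the_inv_f_f[OF inj_C])

lemma states_cases:
  assumes "st \<in> states"
  obtains t M a where "st = (C t # M, a)" "C t # M \<in> V" "t \<in> carrier P" "coset_rep P B t = t"
      "even (length M) = par" "M \<noteq> [] \<Longrightarrow> t \<notin> B" "M \<in> V" "a \<in> carrier Q"
  | x M a where "st = (x # M, a)" "x # M \<in> V" "x \<notin> range C" "even (length (x # M)) = par" "a \<in> carrier Q"
proof -
  obtain x M a where st: "st = (x # M, a)" "x # M \<in> V" "a \<in> carrier Q"
    using assms by (auto simp: states_def neq_Nil_conv)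
  show ?thesis
  proof (cases "x \<in> range C")
    case True
    then obtain t where "x = C t" by auto
    then show ?thesis using that(1) st V_Cons by metis
  next
    case False
    then show ?thesis using that(2) st V_Cons_other[of x M] by auto
  qed
qed

lemma split_closed: "st \<in> states \<Longrightarrow> split st \<in> split_states"
  by (erule states_cases) (auto simp: split_simps split_states_def psi_closed)

lemma join_split: "st \<in> states \<Longrightarrow> join (split st) = st"
proof (erule states_cases)
  fix t M a
  assume st: "st = (C t # M, a)" "t \<in> carrier P" "coset_rep P B t = t"
    "M \<noteq> [] \<Longrightarrow> t \<notin> B" "a \<in> carrier Q"
  have "t \<otimes>\<^bsub>P\<^esub> \<psi> a \<in> B \<longleftrightarrow> t \<in> B" "coset_rep P B (t \<otimes>\<^bsub>P\<^esub> \<psi> a) = t"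
    using P.subgroup_mult_cancel_right[OF B_subgroup psi_in_B] P.coset_rep_mult[OF B_subgroup psi_in_B] st
    by simp_all
  moreover have "inv\<^bsub>P\<^esub> t \<otimes>\<^bsub>P\<^esub> (t \<otimes>\<^bsub>P\<^esub> \<psi> a) = \<psi> a"
    using st psi_closed by (simp flip: P.m_assoc)
  ultimately show ?thesis
    using st(4,5) unfolding st(1) by (cases "M = []") (simp_all add: split_simps join_def psi'_psi)
next
  fix x M a
  assume "st = (x # M, a)" "x \<notin> range C" "a \<in> carrier Q"
  then show ?thesis
    by (simp add: split_simps join_def psi'_psi psi_in_B)
qed

lemma V_hd: "M \<in> V \<Longrightarrow> M \<noteq> [] \<Longrightarrow> even (length M) = par \<Longrightarrow> hd M \<notin> range C"
  using V_Cons by (cases M) auto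

lemma split_join: "z \<in> split_states \<Longrightarrow> split (join z) = z"
  using V_hd rep_mult_rel rep_rel
  by (auto simp: split_states_def join_def split_simps psi_psi')

lemma join_closed:
  assumes "z \<in> split_states"
  shows "join z \<in> states"
proof -
  obtain M y where z: "z = (M, y)" "M \<in> V" "even (length M) = par" "y \<in> carrier P"
    using assms by (auto simp: split_states_def)
  have "C (coset_rep P B y) # M \<in> V" if "\<not> (y \<in> B \<and> M \<noteq> [])"
    using that z rep_closed[OF z(4)] V_Cons P.coset_rep_idem[OF B_subgroup z(4)]
      P.coset_rep_mem_iff[OF B_subgroup z(4)] by auto
  then show ?thesis
    using z rep_rel[OF z(4)] by (auto simp: states_def join_def psi'_closed)
qed

lemma shift_closed:
  assumes "st \<in> states" "x \<in> carrier P"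
  shows "shift x st \<in> states" and "split (shift x st) = (fst (split st), snd (split st) \<otimes>\<^bsub>P\<^esub> x)"
proof -
  have "(fst (split st), snd (split st) \<otimes>\<^bsub>P\<^esub> x) \<in> split_states"
    using split_closed[OF assms(1)] assms(2) by (auto simp: split_states_def)
  then show "shift x st \<in> states" "split (shift x st) = (fst (split st), snd (split st) \<otimes>\<^bsub>P\<^esub> x)"
    using join_closed split_join by (auto simp: shift_def)
qed

lemma split_snd_closed: "st \<in> states \<Longrightarrow> snd (split st) \<in> carrier P"
  using split_closed by (fastforce simp: split_states_def)

lemma shift_mult:
  assumes "st \<in> states" "x \<in> carrier P" "y \<in> carrier P"
  shows "shift y (shift x st) = shift (x \<otimes>\<^bsub>P\<^esub> y) st"
  using shift_closed(2)[OF assms(1,2)] split_snd_closed[OF assms(1)] assms(2,3)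
  by (simp add: shift_def[of y] shift_def[of "x \<otimes>\<^bsub>P\<^esub> y"] P.m_assoc)

lemma shift_one: "st \<in> states \<Longrightarrow> shift \<one>\<^bsub>P\<^esub> st = st"
  using join_split split_snd_closed by (simp add: shift_def)

text \<open>Right multiplication on the split coordinate is free. At the normal form of the identity
  this yields injectivity of the factor in the amalgam.\<close>

lemma shift_inject:
  assumes "st \<in> states" "x \<in> carrier P" "y \<in> carrier P" "shift x st = shift y st"
  shows "x = y"
proof -
  have "snd (split st) \<otimes>\<^bsub>P\<^esub> x = snd (split st) \<otimes>\<^bsub>P\<^esub> y"
    using shift_closed(2)[OF assms(1,2)] shift_closed(2)[OF assms(1,3)] assms(4) by (metis snd_conv)
  then show ?thesis using assms(2,3) split_snd_closed[OF assms(1)] by simp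
qed

text \<open>Elements of the amalgamated subgroup change only the last component, in a way that does
  not depend on the side; this makes the two actions compatible.\<close>

lemma shift_psi:
  assumes "(L, a) \<in> states" "b \<in> carrier Q"
  shows "shift (\<psi> b) (L, a) = (L, a \<otimes>\<^bsub>Q\<^esub> b)"
proof -
  have aC: "a \<in> carrier Q" and L: "L \<in> V" "L \<noteq> []" using assms by (auto simp: states_def)
  have "split (L, a \<otimes>\<^bsub>Q\<^esub> b) = (fst (split (L, a)), snd (split (L, a)) \<otimes>\<^bsub>P\<^esub> \<psi> b)"
    using assms(1)
    by (rule states_cases) (use assms(2) aC in \<open>auto simp: split_simps psi_mult P.m_assoc psi_closed\<close>)
  moreover have "(L, a \<otimes>\<^bsub>Q\<^esub> b) \<in> states"
    using assms aC L by (simp add: states_def)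
  ultimately show ?thesis
    using join_split by (metis shift_def)
qed

lemma path_value_closed: "set M \<subseteq> \<kappa> -` carrier G \<Longrightarrow> path_value G \<kappa> M \<in> carrier G"
  by (induction M) auto

lemma V_path_value_closed: "M \<in> V \<Longrightarrow> path_value G \<kappa> M \<in> carrier G"
  using path_value_closed V_closed by blast

lemma kappa_closed: "p \<in> carrier P \<Longrightarrow> \<kappa> (C p) \<in> carrier G"
  using kappa_hom by (auto simp: hom_def)

lemma kappa_mult: "p \<in> carrier P \<Longrightarrow> q \<in> carrier P \<Longrightarrow> \<kappa> (C (p \<otimes>\<^bsub>P\<^esub> q)) = \<kappa> (C p) \<otimes>\<^bsub>G\<^esub> \<kappa> (C q)"
  using kappa_hom by (auto simp: hom_def)

definition split_val :: "'x list \<times> 'p \<Rightarrow> 'g" where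
  "split_val z = path_value G \<kappa> (fst z) \<otimes>\<^bsub>G\<^esub> \<kappa> (C (snd z))"

lemma split_val_split:
  assumes "st \<in> states"
  shows "split_val (split st) = val st"
  using assms
proof (rule states_cases)
  fix t M a
  assume "st = (C t # M, a)" "M \<in> V" "t \<in> carrier P" "a \<in> carrier Q"
  then show ?thesis
    by (simp add: split_simps val_def split_val_def iota kappa_mult psi_closed kappa_closed
        V_path_value_closed G.m_assoc)
next
  fix x M a
  assume "st = (x # M, a)" "x \<notin> range C" "a \<in> carrier Q"
  then show ?thesis
    by (simp add: split_simps val_def split_val_def iota)
qed

lemma val_shift:
  assumes "st \<in> states" "x \<in> carrier P"
  shows "val (shift x st) = val st \<otimes>\<^bsub>G\<^esub> \<kappa> (C x)"
proof -
  have "val (shift x st) = split_val (fst (split st), snd (split st) \<otimes>\<^bsub>P\<^esub> x)"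
    using split_val_split[OF shift_closed(1)[OF assms]] shift_closed(2)[OF assms] by simp
  also have "\<dots> = split_val (split st) \<otimes>\<^bsub>G\<^esub> \<kappa> (C x)"
    using split_closed[OF assms(1)] assms(2)
    by (auto simp: split_val_def split_states_def kappa_mult kappa_closed V_path_value_closed G.m_assoc)
  finally show ?thesis using split_val_split[OF assms(1)] by simp
qed

text \<open>The two ends of an edge have codes of different parity, so exactly one belongs to this
  side, and \<open>split\<close> computes it.\<close>

lemma fst_split_iff:
  assumes "st \<in> states" "even (length M) = par"
  shows "rev (fst st) \<in> one_step (rev M) \<longleftrightarrow> fst (split st) = M"
  using assms(1)
proof (rule states_cases)
  fix t M' a
  assume st: "st = (C t # M', a)" "even (length M') = par"
  then have "C t # M' \<noteq> M" using assms(2) by auto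
  then show ?thesis using st unfolding rev_one_step by (auto simp: split_simps)
next
  fix x M' a
  assume st: "st = (x # M', a)" "x \<notin> range C" "even (length (x # M')) = par"
  then have "M' \<noteq> M" using assms(2) by auto
  then show ?thesis using st unfolding rev_one_step by (auto simp: split_simps)
qed

text \<open>Right multiplication by the factor fixes the list part of \<open>split\<close>.
  Conversely, elements with the same list part are one path value times two elements of the factor,
  and the path value cancels in the quotient.\<close>

lemma coset_iff:
  assumes st: "\<And>g. g \<in> carrier G \<Longrightarrow> st g \<in> states \<and> val (st g) = g"
    and st_shift: "\<And>g x. g \<in> carrier G \<Longrightarrow> x \<in> carrier P \<Longrightarrow> st (g \<otimes>\<^bsub>G\<^esub> \<kappa> (C x)) = shift x (st g)"
    and C: "q \<in> carrier G" "q' \<in> carrier G"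
  shows "inv\<^bsub>G\<^esub> q \<otimes>\<^bsub>G\<^esub> q' \<in> (\<lambda>p. \<kappa> (C p)) ` carrier P \<longleftrightarrow>
    (\<exists>M. even (length M) = par \<and> rev (fst (st q)) \<in> one_step M \<and> rev (fst (st q')) \<in> one_step M)"
    (is "?L \<longleftrightarrow> ?R")
proof
  assume ?L
  then obtain x where x: "x \<in> carrier P" "inv\<^bsub>G\<^esub> q \<otimes>\<^bsub>G\<^esub> q' = \<kappa> (C x)" by auto
  have "q \<otimes>\<^bsub>G\<^esub> (inv\<^bsub>G\<^esub> q \<otimes>\<^bsub>G\<^esub> q') = q'" using C by (simp flip: G.m_assoc)
  then have "st q' = shift x (st q)" using st_shift[OF C(1) x(1)] x(2) by simp
  then have "fst (split (st q')) = fst (split (st q))"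
    using shift_closed(2) st C x by simp
  moreover have "even (length (fst (split (st q)))) = par"
    using split_closed[of "st q"] st C by (cases "split (st q)") (auto simp: split_states_def)
  ultimately show ?R
    using fst_split_iff[of "st q" "fst (split (st q))"] fst_split_iff[of "st q'" "fst (split (st q))"] st C
    by (intro exI[of _ "rev (fst (split (st q)))"]) simp
next
  assume ?R
  then obtain M where M: "even (length M) = par" "rev (fst (st q)) \<in> one_step M"
    "rev (fst (st q')) \<in> one_step M" by auto
  have fst: "fst (split (st q)) = rev M" "fst (split (st q')) = rev M"
    using fst_split_iff[of "st q" "rev M"] fst_split_iff[of "st q'" "rev M"] M st C by simp_all
  define y where "y = snd (split (st q))"
  define y' where "y' = snd (split (st q'))"
  have y: "y \<in> carrier P" "y' \<in> carrier P"
    using split_snd_closed st C by (auto simp: y_def y'_def)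
  have sp: "split (st q) = (rev M, y)" "split (st q') = (rev M, y')"
    using fst by (simp_all add: y_def y'_def prod_eq_iff)
  have "rev M \<in> V" using split_closed[of "st q"] st C sp by (auto simp: split_states_def)
  then have pC: "path_value G \<kappa> (rev M) \<in> carrier G" by (rule V_path_value_closed)
  have q: "q = path_value G \<kappa> (rev M) \<otimes>\<^bsub>G\<^esub> \<kappa> (C y)" "q' = path_value G \<kappa> (rev M) \<otimes>\<^bsub>G\<^esub> \<kappa> (C y')"
    using split_val_split[of "st q"] split_val_split[of "st q'"] st C sp by (auto simp: split_val_def)
  have "q \<otimes>\<^bsub>G\<^esub> \<kappa> (C (inv\<^bsub>P\<^esub> y \<otimes>\<^bsub>P\<^esub> y')) = path_value G \<kappa> (rev M) \<otimes>\<^bsub>G\<^esub> \<kappa> (C (y \<otimes>\<^bsub>P\<^esub> (inv\<^bsub>P\<^esub> y \<otimes>\<^bsub>P\<^esub> y')))"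
    using y pC by (simp add: q kappa_mult kappa_closed G.m_assoc)
  also have "y \<otimes>\<^bsub>P\<^esub> (inv\<^bsub>P\<^esub> y \<otimes>\<^bsub>P\<^esub> y') = y'" using y by (simp flip: P.m_assoc)
  finally have "q \<otimes>\<^bsub>G\<^esub> \<kappa> (C (inv\<^bsub>P\<^esub> y \<otimes>\<^bsub>P\<^esub> y')) = q'" using q by simp
  then have "inv\<^bsub>G\<^esub> q \<otimes>\<^bsub>G\<^esub> q' = \<kappa> (C (inv\<^bsub>P\<^esub> y \<otimes>\<^bsub>P\<^esub> y'))"
    using C y kappa_closed by (metis G.inv_solve_left P.inv_closed P.m_closed)
  then show ?L using y by auto
qed

end

section \<open>The group of classes of words\<close>

locale amalgam = H: group H + K: group K
  for H :: "('h, 'c) monoid_scheme" and K :: "('k, 'd) monoid_scheme" +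
  fixes A :: "'h set" and B :: "'k set" and \<phi> :: "'h \<Rightarrow> 'k"
  assumes A_subgroup: "subgroup A H" and B_subgroup: "subgroup B K"
    and phi_iso: "\<phi> \<in> iso (H\<lparr>carrier := A\<rparr>) (K\<lparr>carrier := B\<rparr>)"
begin

abbreviation G :: "('h + 'k) list set monoid" where "G \<equiv> amalg_prod H K A \<phi>"
abbreviation cls :: "('h + 'k) list \<Rightarrow> ('h + 'k) list set" where "cls \<equiv> amalg_class H K A \<phi>"
abbreviation rel :: "('h + 'k) list \<Rightarrow> ('h + 'k) list \<Rightarrow> bool" (infix "\<approx>" 50)
  where "u \<approx> v \<equiv> amalg_rel H K A \<phi> u v"
abbreviation letters :: "('h + 'k) set" where "letters \<equiv> amalg_letters H K"

lemma A_closed: "a \<in> A \<Longrightarrow> a \<in> carrier H"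
  using A_subgroup subgroup.mem_carrier by metis

lemma phi_in_B: "a \<in> A \<Longrightarrow> \<phi> a \<in> B"
  using phi_iso bij_betwE by (fastforce simp: iso_def)

lemma phi_image: "\<phi> ` A = B"
  using phi_iso by (auto simp: iso_def bij_betw_def)

lemma phi_closed: "a \<in> A \<Longrightarrow> \<phi> a \<in> carrier K"
  using phi_in_B B_subgroup subgroup.mem_carrier by metis

lemma rel_letters: "u \<approx> v \<Longrightarrow> set u \<subseteq> letters \<and> set v \<subseteq> letters"
  by (induction rule: amalg_rel.induct) (auto simp: amalg_letters_def A_closed phi_closed)

lemma cls_eq: "u \<approx> v \<Longrightarrow> cls u = cls v"
  unfolding amalg_class_def using amalg_rel.sym amalg_rel.trans by blast

lemma cls_self: "set u \<subseteq> letters \<Longrightarrow> u \<in> cls u"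
  by (simp add: amalg_class_def amalg_rel.refl)

lemma mem_cls: "u \<in> cls v \<Longrightarrow> v \<approx> u"
  by (simp add: amalg_class_def)

lemma G_carrier: "carrier G = cls ` {w. set w \<subseteq> letters}"
  by (simp add: amalg_prod_def)

lemma G_one: "\<one>\<^bsub>G\<^esub> = cls []"
  by (simp add: amalg_prod_def)

lemma G_mult:
  assumes "set u \<subseteq> letters" "set v \<subseteq> letters"
  shows "cls u \<otimes>\<^bsub>G\<^esub> cls v = cls (u @ v)"
proof -
  have "(\<exists>u'\<in>cls u. \<exists>v'\<in>cls v. u' @ v' \<approx> w) \<longleftrightarrow> u @ v \<approx> w" for w
  proof
    assume "\<exists>u'\<in>cls u. \<exists>v'\<in>cls v. u' @ v' \<approx> w"
    then obtain u' v' where "u \<approx> u'" "v \<approx> v'" "u' @ v' \<approx> w" by (auto simp: amalg_class_def)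
    then show "u @ v \<approx> w" using amalg_rel.append amalg_rel.trans by metis
  qed (use assms cls_self in blast)
  then show ?thesis by (simp add: amalg_prod_def amalg_class_def)
qed

definition inv_letter :: "'h + 'k \<Rightarrow> 'h + 'k" where
  "inv_letter x = (case x of Inl h \<Rightarrow> Inl (inv\<^bsub>H\<^esub> h) | Inr k \<Rightarrow> Inr (inv\<^bsub>K\<^esub> k))"

lemma inv_letter:
  assumes "x \<in> letters"
  shows "inv_letter x \<in> letters" "[inv_letter x, x] \<approx> []"
proof -
  show "inv_letter x \<in> letters" using assms by (auto simp: inv_letter_def amalg_letters_def)
  show "[inv_letter x, x] \<approx> []"
  proof (cases x)
    case (Inl h)
    then have "h \<in> carrier H" using assms by (auto simp: amalg_letters_def)
    then have "[Inl (inv\<^bsub>H\<^esub> h), Inl h] \<approx> [Inl \<one>\<^bsub>H\<^esub>]"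
      using amalg_rel.multH[of "inv\<^bsub>H\<^esub> h" H h K A \<phi>] by simp
    then show ?thesis using Inl amalg_rel.trans[OF _ amalg_rel.oneH] by (simp add: inv_letter_def)
  next
    case (Inr k)
    then have "k \<in> carrier K" using assms by (auto simp: amalg_letters_def)
    then have "[Inr (inv\<^bsub>K\<^esub> k), Inr k] \<approx> [Inr \<one>\<^bsub>K\<^esub>]"
      using amalg_rel.multK[of "inv\<^bsub>K\<^esub> k" K k H A \<phi>] by simp
    then show ?thesis using Inr amalg_rel.trans[OF _ amalg_rel.oneK] by (simp add: inv_letter_def)
  qed
qed

lemma left_inverse_word:
  "set w \<subseteq> letters \<Longrightarrow> \<exists>v. set v \<subseteq> letters \<and> v @ w \<approx> []"
proof (induction w)
  case Nil
  then show ?case using amalg_rel.refl[of "[]"] by (intro exI[of _ "[]"]) auto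
next
  case (Cons x w)
  then obtain v where v: "set v \<subseteq> letters" "v @ w \<approx> []" by auto
  have x: "inv_letter x \<in> letters" "[inv_letter x, x] \<approx> []" using inv_letter Cons.prems by auto
  have "(v @ [inv_letter x, x]) @ w \<approx> (v @ []) @ w"
    using x v Cons.prems by (intro amalg_rel.append amalg_rel.refl) auto
  then have "(v @ [inv_letter x]) @ x # w \<approx> []"
    using v(2) amalg_rel.trans by auto
  then show ?case using v x by (intro exI[of _ "v @ [inv_letter x]"]) auto
qed

sublocale G: group G
proof (rule groupI)
  fix x y z assume "x \<in> carrier G" "y \<in> carrier G" "z \<in> carrier G"
  then obtain u v w where "x = cls u" "y = cls v" "z = cls w"
    "set u \<subseteq> letters" "set v \<subseteq> letters" "set w \<subseteq> letters" by (auto simp: G_carrier)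
  then show "x \<otimes>\<^bsub>G\<^esub> y \<otimes>\<^bsub>G\<^esub> z = x \<otimes>\<^bsub>G\<^esub> (y \<otimes>\<^bsub>G\<^esub> z)"
    by (simp add: G_mult)
next
  fix x y assume "x \<in> carrier G" "y \<in> carrier G"
  then show "x \<otimes>\<^bsub>G\<^esub> y \<in> carrier G"
    by (auto simp: G_carrier G_mult)
next
  fix x assume "x \<in> carrier G"
  then obtain u where u: "x = cls u" "set u \<subseteq> letters" by (auto simp: G_carrier)
  then obtain v where "set v \<subseteq> letters" "v @ u \<approx> []" using left_inverse_word by blast
  then show "\<exists>y\<in>carrier G. y \<otimes>\<^bsub>G\<^esub> x = \<one>\<^bsub>G\<^esub>"
    using u cls_eq by (intro bexI[of _ "cls v"]) (auto simp: G_carrier G_mult G_one)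
  show "\<one>\<^bsub>G\<^esub> \<otimes>\<^bsub>G\<^esub> x = x"
    using u by (simp add: G_one G_mult)
qed (auto simp: G_carrier G_one)

section \<open>Normal forms and the combined action of both factors\<close>

text \<open>Lists are built up from the end: the last entry comes from \<open>H\<close> and may be
  trivial, and the parity of the remaining length makes the letters alternate between
  \<open>H\<close> and \<open>K\<close>.\<close>

fun valid :: "('h + 'k) list \<Rightarrow> bool" where
  "valid [] \<longleftrightarrow> True"
| "valid (Inl t # M) \<longleftrightarrow> valid M \<and> even (length M) \<and> t \<in> carrier H \<and> coset_rep H A t = t \<and>
     (M \<noteq> [] \<longrightarrow> t \<notin> A)"
| "valid (Inr t # M) \<longleftrightarrow> valid M \<and> odd (length M) \<and> t \<in> carrier K \<and> coset_rep K B t = t \<and>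
     (M \<noteq> [] \<longrightarrow> t \<notin> B)"

lemma valid_letters: "valid M \<Longrightarrow> set M \<subseteq> letters"
  by (induction M rule: valid.induct) (auto simp: amalg_letters_def)

lemma letter_closed: "x \<in> letters \<Longrightarrow> cls [x] \<in> carrier G"
  by (auto simp: G_carrier)

lemma inl_hom: "(\<lambda>h. cls [Inl h]) \<in> hom H G"
  using cls_eq[OF amalg_rel.multH] by (auto simp: hom_def G_carrier G_mult amalg_letters_def)

lemma inr_hom: "(\<lambda>k. cls [Inr k]) \<in> hom K G"
  using cls_eq[OF amalg_rel.multK] by (auto simp: hom_def G_carrier G_mult amalg_letters_def)

lemma A_group: "group (H\<lparr>carrier := A\<rparr>)"
  using A_subgroup H.subgroup_imp_group by blast

text \<open>Both sides store the amalgamated part in \<open>A\<close>, embedded by the identity for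
  \<open>H\<close> and by \<open>\<phi>\<close> for \<open>K\<close>, so both factors act on one and
  the same set of states.\<close>

sublocale SH: amalgam_side H "H\<lparr>carrier := A\<rparr>" G A "\<lambda>a. a" Inl "Collect valid" True
  "\<lambda>x. cls [x]" "\<lambda>a. cls [Inl a]"
proof (intro amalgam_side.intro amalgam_side_axioms.intro)
  show "(\<lambda>a. a) \<in> iso (H\<lparr>carrier := A\<rparr>) (H\<lparr>carrier := A\<rparr>)"
    by (auto simp: iso_def hom_def bij_betw_def)
  fix x M
  show "x # M \<in> Collect valid \<Longrightarrow> x \<notin> range Inl \<Longrightarrow> even (length M) \<noteq> True"
    by (cases x) auto
  show "M \<in> Collect valid \<Longrightarrow> x \<in> set M \<Longrightarrow> cls [x] \<in> carrier G"
    using valid_letters letter_closed by blast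
qed (use H.group_axioms A_group G.group_axioms A_subgroup inl_hom in auto)

sublocale SK: amalgam_side K "H\<lparr>carrier := A\<rparr>" G B \<phi> Inr "Collect valid" False
  "\<lambda>x. cls [x]" "\<lambda>a. cls [Inl a]"
proof (intro amalgam_side.intro amalgam_side_axioms.intro)
  fix x M
  show "x # M \<in> Collect valid \<Longrightarrow> x \<notin> range Inr \<Longrightarrow> even (length M) \<noteq> False"
    by (cases x) auto
  show "M \<in> Collect valid \<Longrightarrow> x \<in> set M \<Longrightarrow> cls [x] \<in> carrier G"
    using valid_letters letter_closed by blast
next
  fix a assume "a \<in> carrier (H\<lparr>carrier := A\<rparr>)"
  then show "cls [Inl a] = cls [Inr (\<phi> a)]" using cls_eq[OF amalg_rel.amalg[of a A H K \<phi>]] by simp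
qed (use K.group_axioms A_group G.group_axioms B_subgroup inr_hom phi_iso in auto)

abbreviation "states \<equiv> SH.states"

definition act :: "'h + 'k \<Rightarrow> ('h + 'k) list \<times> 'h \<Rightarrow> ('h + 'k) list \<times> 'h" where
  "act x = (case x of Inl h \<Rightarrow> SH.shift h | Inr k \<Rightarrow> SK.shift k)"

definition run :: "('h + 'k) list \<Rightarrow> ('h + 'k) list \<times> 'h \<Rightarrow> ('h + 'k) list \<times> 'h" where
  "run w st = foldl (\<lambda>st x. act x st) st w"

lemma run_simps [simp]: "run [] st = st" "run (x # w) st = run w (act x st)"
  "run (u @ v) st = run v (run u st)"
  by (simp_all add: run_def)

lemma act_closed: "x \<in> letters \<Longrightarrow> st \<in> states \<Longrightarrow> act x st \<in> states"
  using SH.shift_closed(1)[of st] SK.shift_closed(1)[of st]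
  by (auto simp: act_def amalg_letters_def)

lemma run_closed: "set w \<subseteq> letters \<Longrightarrow> st \<in> states \<Longrightarrow> run w st \<in> states"
  by (induction w arbitrary: st) (auto simp: act_closed)

text \<open>The defining relations hold for the action: within a factor because it acts, and for the
  amalgamation because both sides obey \<open>shift_psi\<close>. Hence normal forms are well defined
  on classes.\<close>

lemma run_rel: "u \<approx> v \<Longrightarrow> st \<in> states \<Longrightarrow> run u st = run v st"
proof (induction arbitrary: st rule: amalg_rel.induct)
  case (append u v u' v')
  then show ?case using rel_letters run_closed by simp
next
  case (multH x y)
  then show ?case by (simp add: act_def SH.shift_mult)
next
  case oneH
  then show ?case by (simp add: act_def SH.shift_one)
next
  case (multK x y)
  then show ?case by (simp add: act_def SK.shift_mult)
next
  case oneK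
  then show ?case by (simp add: act_def SK.shift_one)
next
  case (amalg a)
  obtain L b where "st = (L, b)" by (cases st)
  then show ?case
    using amalg SH.shift_psi[of L b a] SK.shift_psi[of L b a] by (simp add: act_def)
qed auto

text \<open>The normal form of the identity. Its list has length one and codes the edge
  \<open>A\<close> at the base vertex.\<close>

definition start :: "('h + 'k) list \<times> 'h" where
  "start = ([Inl \<one>\<^bsub>H\<^esub>], \<one>\<^bsub>H\<^esub>)"

lemma one_in_A: "\<one>\<^bsub>H\<^esub> \<in> A"
  using A_subgroup subgroup.one_closed by metis

lemma start_states: "start \<in> states"
  by (simp add: start_def SH.states_def one_in_A coset_rep_def)

definition nf :: "('h + 'k) list set \<Rightarrow> ('h + 'k) list \<times> 'h" where
  "nf g = run (SOME w. w \<in> g) start"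

lemma nf_cls: "set w \<subseteq> letters \<Longrightarrow> nf (cls w) = run w start"
  unfolding nf_def using someI[of "\<lambda>v. v \<in> cls w" w] cls_self[of w] mem_cls run_rel start_states by metis

lemma val_run:
  "set w \<subseteq> letters \<Longrightarrow> SH.val (run w start) = cls w"
proof (induction w rule: rev_induct)
  case Nil
  have "[Inl \<one>\<^bsub>H\<^esub>] \<approx> []" by (rule amalg_rel.oneH)
  then have "cls [Inl \<one>\<^bsub>H\<^esub>] = \<one>\<^bsub>G\<^esub>" using cls_eq by (simp add: G_one)
  then show ?case by (simp add: SH.val_def start_def G_one G_mult)
next
  case (snoc x w)
  have st: "run w start \<in> states" using run_closed start_states snoc.prems by auto
  have "SH.val (act x (run w start)) = SH.val (run w start) \<otimes>\<^bsub>G\<^esub> cls [x]"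
    using snoc.prems SH.val_shift[OF st] SK.val_shift[of "run w start"] st
    by (auto simp: act_def amalg_letters_def)
  then show ?case using snoc by (simp add: G_mult)
qed

lemma nf_closed: "g \<in> carrier G \<Longrightarrow> nf g \<in> states \<and> SH.val (nf g) = g"
  using nf_cls val_run run_closed[OF _ start_states] by (auto simp: G_carrier)

lemma nf_mult: "g \<in> carrier G \<Longrightarrow> x \<in> letters \<Longrightarrow> nf (g \<otimes>\<^bsub>G\<^esub> cls [x]) = act x (nf g)"
  using nf_cls by (auto simp: G_carrier G_mult)

text \<open>Equal classes act equally on \<open>start\<close>, and each factor acts freely.\<close>

lemma inl_inj: "inj_on (\<lambda>h. cls [Inl h]) (carrier H)"
proof (rule inj_onI)
  fix x y assume xy: "x \<in> carrier H" "y \<in> carrier H" "cls [Inl x] = cls [Inl y]"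
  then have "SH.shift x start = SH.shift y start"
    using nf_cls[of "[Inl x]"] nf_cls[of "[Inl y]"] by (simp add: act_def amalg_letters_def)
  then show "x = y" using SH.shift_inject start_states xy by metis
qed

lemma inr_inj: "inj_on (\<lambda>k. cls [Inr k]) (carrier K)"
proof (rule inj_onI)
  fix x y assume xy: "x \<in> carrier K" "y \<in> carrier K" "cls [Inr x] = cls [Inr y]"
  then have "SK.shift x start = SK.shift y start"
    using nf_cls[of "[Inr x]"] nf_cls[of "[Inr y]"] by (simp add: act_def amalg_letters_def)
  then show "x = y" using SK.shift_inject start_states xy by metis
qed

section \<open>Generation and hyperbolicity of the amalgam\<close>

lemma inl_group_hom: "group_hom H G (amalg_inl H K A \<phi>)"
  using inl_hom by (simp add: group_hom_def group_hom_axioms_def amalg_inl_def[abs_def]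
      H.group_axioms G.group_axioms)

lemma inr_group_hom: "group_hom K G (amalg_inr H K A \<phi>)"
  using inr_hom by (simp add: group_hom_def group_hom_axioms_def amalg_inr_def[abs_def]
      K.group_axioms G.group_axioms)

lemma amalg_inl_eq: "amalg_inl H K A \<phi> = (\<lambda>h. cls [Inl h])"
  by (simp add: amalg_inl_def fun_eq_iff)

lemma amalg_inr_eq: "amalg_inr H K A \<phi> = (\<lambda>k. cls [Inr k])"
  by (simp add: amalg_inr_def fun_eq_iff)

lemma inr_B: "amalg_inr H K A \<phi> ` B = amalg_inl H K A \<phi> ` A"
proof -
  have "amalg_inr H K A \<phi> (\<phi> a) = amalg_inl H K A \<phi> a" if "a \<in> A" for a
    using cls_eq[OF amalg_rel.amalg[OF that]] by (simp add: amalg_inl_def amalg_inr_def)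
  then show ?thesis unfolding phi_image[symmetric] image_image by (rule image_cong[OF HOL.refl])
qed

lemma generate_letters:
  assumes "subgroup Z G" "amalg_inl H K A \<phi> ` carrier H \<subseteq> Z" "amalg_inr H K A \<phi> ` carrier K \<subseteq> Z"
  shows "carrier G \<subseteq> Z"
proof -
  have "cls w \<in> Z" if "set w \<subseteq> letters" for w
    using that
  proof (induction w)
    case Nil
    then show ?case using subgroup.one_closed[OF assms(1)] by (simp add: G_one)
  next
    case (Cons x w)
    then have "cls [x] \<in> Z"
      using assms(2,3) by (auto simp: amalg_letters_def amalg_inl_eq amalg_inr_eq)
    then have "cls [x] \<otimes>\<^bsub>G\<^esub> cls w \<in> Z"
      using Cons subgroup.m_closed[OF assms(1)] by simp
    then show ?case using Cons.prems by (simp add: G_mult)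
  qed
  then show ?thesis by (auto simp: G_carrier)
qed

text \<open>The locale \<open>tree_coding\<close> is instantiated with the images of
  \<open>H\<close> and \<open>K\<close> as vertex groups and with normal forms as path
  codes.\<close>

theorem hyperbolic:
  assumes SH: "A \<subseteq> S" "S \<subseteq> carrier H" "generate H S = carrier H"
    and SK: "B \<subseteq> T" "T \<subseteq> carrier K" "generate K T = carrier K"
    and hypH: "gromov_hyperbolic (carrier H) (\<lambda>x y. real (cayley_dist H S x y))"
    and hypK: "gromov_hyperbolic (carrier K) (\<lambda>x y. real (cayley_dist K T x y))"
  defines "Z \<equiv> amalg_inl H K A \<phi> ` S \<union> amalg_inr H K A \<phi> ` T"
  shows "generate G Z = carrier G"
    and "gromov_hyperbolic (carrier G) (\<lambda>x y. real (cayley_dist G Z x y))"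
proof -
  let ?l = "amalg_inl H K A \<phi>" and ?r = "amalg_inr H K A \<phi>"
  interpret l: group_hom H G ?l by (rule inl_group_hom)
  interpret r: group_hom K G ?r by (rule inr_group_hom)
  have genl: "generate G (?l ` S) = ?l ` carrier H" and genr: "generate G (?r ` T) = ?r ` carrier K"
    using l.generate_img[OF SH(2)] r.generate_img[OF SK(2)] SH(3) SK(3) by auto
  have Z: "Z \<subseteq> carrier G" using SH(2) SK(2) by (auto simp: Z_def)
  have "carrier G \<subseteq> generate G Z"
    using G.mono_generate[of "?l ` S" Z] G.mono_generate[of "?r ` T" Z] genl genr Z
    by (intro generate_letters G.generate_is_subgroup) (auto simp: Z_def)
  then show gen: "generate G Z = carrier G"
    using G.generate_incl[OF Z] by blast
  define P where "P = (\<lambda>i. if i then ?l ` carrier H else ?r ` carrier K)"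
  define S' where "S' = (\<lambda>i. if i then ?l ` S else ?r ` T)"
  \<comment> \<open>Dropping the component in \<open>A\<close> passes to the coset, and reversal
    turns initial segments of the tree path into prefixes.\<close>
  define N where "N = (\<lambda>g. rev (fst (nf g)))"
  interpret T: tree_coding G P "?l ` A" S' N
  proof (intro tree_coding.intro tree_coding_axioms.intro)
    show "group G" by (rule G.group_axioms)
    fix i
    show "subgroup (P i) G"
      using l.subgroup_img_is_subgroup[OF H.subgroup_self] r.subgroup_img_is_subgroup[OF K.subgroup_self]
      by (simp add: P_def)
    show "?l ` A \<subseteq> S' i"
      using image_mono[OF SH(1), of ?l] image_mono[OF SK(1), of ?r] inr_B by (simp add: S'_def)
    show "generate G (S' i) = P i"
      using genl genr by (simp add: P_def S'_def)
    show "generate G (S' True \<union> S' False) = carrier G"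
      using gen by (simp add: S'_def Z_def)
  next
    fix i q q' assume q: "q \<in> carrier G" "q' \<in> carrier G"
    show "inv\<^bsub>G\<^esub> q \<otimes>\<^bsub>G\<^esub> q' \<in> P i \<longleftrightarrow>
      (\<exists>M. even (length M) = i \<and> N q \<in> one_step M \<and> N q' \<in> one_step M)"
    proof (cases i)
      case True
      have "nf (g \<otimes>\<^bsub>G\<^esub> cls [Inl x]) = SH.shift x (nf g)" if "g \<in> carrier G" "x \<in> carrier H" for g x
        using nf_mult[of g "Inl x"] that by (simp add: amalg_letters_def act_def)
      from SH.coset_iff[of nf, OF nf_closed this q] show ?thesis
        using True by (simp add: P_def N_def amalg_inl_eq)
    next
      case False
      have "nf (g \<otimes>\<^bsub>G\<^esub> cls [Inr x]) = SK.shift x (nf g)" if "g \<in> carrier G" "x \<in> carrier K" for g x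
        using nf_mult[of g "Inr x"] that by (simp add: amalg_letters_def act_def)
      from SK.coset_iff[of nf, OF nf_closed this q] show ?thesis
        using False by (simp add: P_def N_def amalg_inr_eq)
    qed
  next
    fix q assume "q \<in> carrier G"
    then show "N q \<noteq> []"
      using nf_closed[of q] by (auto simp: N_def SH.states_def split: prod.splits)
  next
    fix q q' assume q: "q \<in> carrier G" "q' \<in> carrier G" and "N q = N q'"
    \<comment> \<open>Equal lists mean that the two elements differ only in the final factor from
      \<open>A\<close>.\<close>
    obtain L a b where nf: "nf q = (L, a)" "nf q' = (L, b)"
      using \<open>N q = N q'\<close> by (cases "nf q"; cases "nf q'") (auto simp: N_def)
    then have ab: "a \<in> A" "b \<in> A" "L \<in> Collect valid"
      using nf_closed q by (force simp: SH.states_def)+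
    define p where "p = path_value G (\<lambda>x. cls [x]) L"
    have p: "p \<in> carrier G" using SH.V_path_value_closed[OF ab(3)] by (simp add: p_def)
    have qq: "q = p \<otimes>\<^bsub>G\<^esub> ?l a" "q' = p \<otimes>\<^bsub>G\<^esub> ?l b"
      using nf_closed[OF q(1)] nf_closed[OF q(2)] nf by (auto simp: SH.val_def p_def amalg_inl_eq)
    have ab': "a \<in> carrier H" "b \<in> carrier H" using ab A_closed by auto
    have "q \<otimes>\<^bsub>G\<^esub> ?l (inv\<^bsub>H\<^esub> a \<otimes>\<^bsub>H\<^esub> b) = p \<otimes>\<^bsub>G\<^esub> ?l (a \<otimes>\<^bsub>H\<^esub> (inv\<^bsub>H\<^esub> a \<otimes>\<^bsub>H\<^esub> b))"
      using ab' p by (simp add: qq G.m_assoc)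
    also have "a \<otimes>\<^bsub>H\<^esub> (inv\<^bsub>H\<^esub> a \<otimes>\<^bsub>H\<^esub> b) = b" using ab' by (simp flip: H.m_assoc)
    finally have "q \<otimes>\<^bsub>G\<^esub> ?l (inv\<^bsub>H\<^esub> a \<otimes>\<^bsub>H\<^esub> b) = q'" using qq by simp
    then have "inv\<^bsub>G\<^esub> q \<otimes>\<^bsub>G\<^esub> q' = ?l (inv\<^bsub>H\<^esub> a \<otimes>\<^bsub>H\<^esub> b)"
      using q ab' by (metis G.inv_solve_left H.inv_closed H.m_closed l.hom_closed)
    moreover have "inv\<^bsub>H\<^esub> a \<otimes>\<^bsub>H\<^esub> b \<in> A"
      using ab A_subgroup subgroup.m_closed subgroup.m_inv_closed by metis
    ultimately show "inv\<^bsub>G\<^esub> q \<otimes>\<^bsub>G\<^esub> q' \<in> ?l ` A" by blast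
  next
    show "length (N \<one>\<^bsub>G\<^esub>) = 1"
      by (simp add: N_def G_one nf_cls start_def)
  qed
  have "gromov_hyperbolic (P i) (\<lambda>x y. real (cayley_dist G (S' i) x y))" for i
    using hypH hypK inl_inj inr_inj SH(2) SK(2)
    by (cases i) (simp_all add: gromov_hyperbolic_def gromov_product_def P_def S'_def
        l.cayley_dist_image r.cayley_dist_image amalg_inl_eq[symmetric] amalg_inr_eq[symmetric])
  then have "gromov_hyperbolic (carrier G) (\<lambda>x y. real (cayley_dist G T.gens x y))"
    by (rule T.gromov_hyperbolic_amalgam)
  moreover have "T.gens = Z" unfolding T.gens_def Z_def by (simp add: S'_def)
  ultimately show "gromov_hyperbolic (carrier G) (\<lambda>x y. real (cayley_dist G Z x y))" by simp
qed

end

section \<open>Weak relative hyperbolicity of the amalgam\<close>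

text \<open>All distances are at most 1, so Gromov products lie between -1/2 and 1 and the constant
  2 suffices.\<close>

lemma (in group) gromov_hyperbolic_carrier:
  "gromov_hyperbolic (carrier G) (\<lambda>x y. real (cayley_dist G (carrier G) x y))"
proof -
  have "cayley_dist G (carrier G) x y \<le> 1" if "x \<in> carrier G" "y \<in> carrier G" for x y
    using cayley_dist_gen_le[of "carrier G" x y] that by simp
  then have d: "0 \<le> real (cayley_dist G (carrier G) x y)" "real (cayley_dist G (carrier G) x y) \<le> 1"
    if "x \<in> carrier G" "y \<in> carrier G" for x y
    using that by auto
  have "gromov_product (\<lambda>x y. real (cayley_dist G (carrier G) x y)) w x z \<ge>
     min (gromov_product (\<lambda>x y. real (cayley_dist G (carrier G) x y)) w x y)
         (gromov_product (\<lambda>x y. real (cayley_dist G (carrier G) x y)) w y z) - 2"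
    if "x \<in> carrier G" "y \<in> carrier G" "z \<in> carrier G" "w \<in> carrier G" for x y z w
    using d[of x w] d[of y w] d[of z w] d[of x y] d[of y z] d[of x z] that
    unfolding gromov_product_def by (auto simp: min_def field_simps)
  then show ?thesis unfolding gromov_hyperbolic_def by blast
qed

lemma (in group) generate_carrier: "generate G (carrier G) = carrier G"
  using generate_incl[of "carrier G"] by (auto intro: generate.incl)

theorem theorem1p2:
  fixes H :: "('h, 'c) monoid_scheme" and K :: "('k, 'd) monoid_scheme"
    and A :: "'h set" and B :: "'k set" and \<phi> :: "'h \<Rightarrow> 'k"
  assumes "group H" and "group K"
    and "subgroup A H" and "subgroup B K"
    and "\<phi> \<in> iso (H\<lparr>carrier := A\<rparr>) (K\<lparr>carrier := B\<rparr>)"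
  shows "weakly_rel_hyperbolic (amalg_prod H K A \<phi>)
           {amalg_inl H K A \<phi> ` carrier H, amalg_inr H K A \<phi> ` carrier K}
         \<and> (weakly_rel_hyperbolic H {A} \<and> weakly_rel_hyperbolic K {B} \<longrightarrow>
            weakly_rel_hyperbolic (amalg_prod H K A \<phi>) {amalg_inl H K A \<phi> ` A})"
proof -
  interpret amalgam H K A B \<phi>
    using assms by (simp add: amalgam_def amalgam_axioms_def)
  let ?l = "amalg_inl H K A \<phi>" and ?r = "amalg_inr H K A \<phi>"
  have sub: "A \<subseteq> carrier H" "B \<subseteq> carrier K"
    using assms(3,4) subgroup.subset by auto
  interpret l: group_hom H G ?l by (rule inl_group_hom)
  interpret r: group_hom K G ?r by (rule inr_group_hom)
  \<comment> \<open>The two factors already generate, so the finite relative generating set is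
    empty.\<close>
  have "weakly_rel_hyperbolic G {?l ` carrier H, ?r ` carrier K}"
    unfolding weakly_rel_hyperbolic_def
    using hyperbolic[of "carrier H" "carrier K"] sub H.generate_carrier K.generate_carrier
      H.gromov_hyperbolic_carrier K.gromov_hyperbolic_carrier
    by (intro exI[of _ "{}"]) simp
  moreover have "weakly_rel_hyperbolic G {?l ` A}"
    if hyps: "weakly_rel_hyperbolic H {A}" "weakly_rel_hyperbolic K {B}"
  proof -
    obtain U where U: "finite U" "U \<subseteq> carrier H" "generate H (U \<union> A) = carrier H"
      "gromov_hyperbolic (carrier H) (\<lambda>x y. real (cayley_dist H (U \<union> A) x y))"
      using hyps(1) by (auto simp: weakly_rel_hyperbolic_def)
    obtain W where W: "finite W" "W \<subseteq> carrier K" "generate K (W \<union> B) = carrier K"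
      "gromov_hyperbolic (carrier K) (\<lambda>x y. real (cayley_dist K (W \<union> B) x y))"
      using hyps(2) by (auto simp: weakly_rel_hyperbolic_def)
    \<comment> \<open>The images of \<open>A\<close> and \<open>B\<close> coincide in the amalgam,
      so beyond that common subgroup only finitely many generators remain.\<close>
    have eq: "?l ` (U \<union> A) \<union> ?r ` (W \<union> B) = (?l ` U \<union> ?r ` W) \<union> \<Union>{?l ` A}"
      using inr_B by auto
    have "generate G (?l ` (U \<union> A) \<union> ?r ` (W \<union> B)) = carrier G"
      and "gromov_hyperbolic (carrier G) (\<lambda>x y. real (cayley_dist G (?l ` (U \<union> A) \<union> ?r ` (W \<union> B)) x y))"
      using hyperbolic[of "U \<union> A" "W \<union> B"] U W sub by simp_all
    moreover have "finite (?l ` U \<union> ?r ` W)" "?l ` U \<union> ?r ` W \<subseteq> carrier G"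
      using U W by auto
    ultimately show ?thesis
      unfolding weakly_rel_hyperbolic_def eq by blast
  qed
  ultimately show ?thesis by blast
qed

end
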